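(* Let $T\ge2$ and $d\ge3$ be integers, $L>0$ and $D=2R>0$. For any optimality gap $\epsilon>0$, there exists a multistage stochastic convex problem of the form described in the context (with these parameters $T,d,L,D,\epsilon$) such that, if the deterministic sampling dual dynamic programming algorithm described in the context gives $\mathrm{UB}-\mathrm{LB}<\epsilon$ at the $i$-th iteration, then $$i>\frac13\,\frac{d(d-2)\sqrt\pi}{d-1}\,\frac{\Gamma(d/2+1/2)}{\Gamma(d/2+1)}\left(\frac{DL(T-1)}{8\epsilon}\right)^{(d-2)/2}.$$
   Context: $\|\cdot\|$ is the Euclidean norm and $\mathcal X=\{x\in\mathbb R^d:\|x\|\le R\}$; all state spaces equal $\mathcal X$. $\mathcal S^{d-1}(R)=\{x\in\mathbb R^d:\|x\|=R\}$. **Problem form.** Choose any $L_1,\dots,L_T$ with $L/2\le L_T<L_{T-1}<\dots<L_1\le L$. For $t=1,\dots,T-1$ put $\beta_t=\frac{\epsilon}{(T-1)L_{t+1}}$, and let $\mathcal W_t=\{w_{t,k}\}_{k=1}^{K_t}\subset\mathcal S^{d-1}(R)$ be a finite set of $K_t$ points such that $\langle w_{t,l}-w_{t,k},w_{t,k}\rangle<-\beta_tR$ for all $l\ne k$, and $K_t\ge\frac{d(d-2)\sqrt\pi}{d-1}\frac{\Gamma(d/2+1/2)}{\Gamma(d/2+1)}\left(\frac{R}{2\beta_t}\right)^{(d-2)/2}$. Choose values $v_{t,k}\in\left(\frac{\epsilon}{2(T-1)},\frac{\epsilon}{T-1}\right)$ and define $F_t(x)=\max_{1\le k\le K_t}\{0,\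 v_{t,k}+\frac{L_{t+1}}{R}\langle w_{t,k},x-w_{t,k}\rangle\}$ on $\mathcal X$ for $1\le t\le T-1$, and $F_0\equiv0$. The scenario tree is stagewise independent: stage $t$ has $K_t$ equiprobable nodes $(t,k)$, $1\le k\le K_t$, for $1\le t\le T-1$, and stage $T$ has the single node $(T,1)$ ($K_T=1$). The root cost is $0$, and the value functions are $$Q_{t,k}(x_{t-1})=\min_{x_t\in\mathcal X}\{F_{t-1}(x_{t-1})+L_t\|x_t-w_{t,k}\|+\mathcal Q_t(x_t)\}\ (1\le t\le T-1),\qquad Q_{T,1}(x_{T-1})=F_{T-1}(x_{T-1}),$$ with expected cost-to-go $\mathcal Q_t(x)=\frac1{K_{t+1}}\sum_{k=1}^{K_{t+1}}Q_{t+1,k}(x)$, $0\le t\le T-1$; the root problem is $\min_{x_0\in\mathcal X}\mathcal Q_0(x_0)$. **Algorithm on this problem** (penalty functions $\psi=\|\cdot\|$, penalty parameter $L_t$ at stage-$t$ nodes, linear cuts with dual bounds $l_\lambda=L_t$, $l_\rho=0$). Write $g_{t,k}(x)=L_t\|x-w_{t,k}\|$ for $t\le T-1$ and $g_{T,1}\equiv0$. "An optimal solution" means any optimal solution. Initialize $\underline{\mathcal Q}_t^0\equiv0$, $\overline{\mathcal Q}_t^0\equiv+\infty$ for $0\le t\le T-1$, $\underline{\mathcal Q}_T^i\equiv\overline{\mathcal Q}_T^i\equiv0$ for all $i$; $x_0^1\in\mathcal X$ arbitrary; $\mathrm{LB}=0$, $\mathrm{UB}=+\infty$. Iterations $i=1,2,\dots$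 are performed as long as $\mathrm{UB}-\mathrm{LB}>\epsilon$; iteration $i$ consists of: (Forward) for $t=1,\dots,T$ and each $k$, $(x_{t,k}^i,z_{t,k}^i)$ is an optimal solution of $\min_{x,z\in\mathcal X}\{F_{t-1}(z)+L_t\|x_{t-1}^i-z\|+g_{t,k}(x)+\underline{\mathcal Q}_t^{i-1}(x)\}$; for $t\le T-1$ set $x_t^i=x_{t,k^*}^i$ for any $k^*$ maximizing the gap $\overline{\mathcal Q}_t^{i-1}(x_{t,k}^i)-\underline{\mathcal Q}_t^{i-1}(x_{t,k}^i)$ over $k$. (Backward) for $t=T,\dots,1$ and each $k$ (with $\underline{\mathcal Q}_t^i,\overline{\mathcal Q}_t^i$ already updated): $\underline v_{t,k}^i$ is the optimal value and $\hat\lambda_{t,k}^i$ an optimal outer solution of $\max_{\|\lambda\|\le L_t}\min_{x,z\in\mathcal X}\{F_{t-1}(z)+\langle\lambda,x_{t-1}^i-z\rangle+g_{t,k}(x)+\underline{\mathcal Q}_t^i(x)\}$, and $\bar v_{t,k}^i=F_{t-1}(z_{t,k}^i)+L_t\|x_{t-1}^i-z_{t,k}^i\|+g_{t,k}(x_{t,k}^i)+\overline{\mathcal Q}_t^i(x_{t,k}^i)$; then $$\underline{\mathcal Q}_{t-1}^i(x)=\max\Big\{\underline{\mathcal Q}_{t-1}^{i-1}(x),\ \tfrac1{K_t}\sum_{k=1}^{K_t}\big(\underline v_{t,k}^i-\langle\hat\lambda_{t,k}^i,x_{t-1}^i-x\rangle\big)\Big\},$$ $$\overline{\mathcal Q}_{t-1}^i=\mathrm{conv}\Big\{\overline{\mathcal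 Q}_{t-1}^{i-1},\ \tfrac1{K_t}\sum_{k=1}^{K_t}\big(\bar v_{t,k}^i+L_t\|\cdot-x_{t-1}^i\|\big)\Big\},$$ where $\mathrm{conv}\{f,g\}$ is the convex biconjugate of $\min\{f,g\}$ on $\mathbb R^d$. (Root) $x_0^{i+1}$ is an optimal solution of $\min_{x\in\mathcal X}\underline{\mathcal Q}_0^i(x)$; $\mathrm{LB}=\underline{\mathcal Q}_0^i(x_0^{i+1})$, and $\mathrm{UB}$ is replaced by $\min\{\mathrm{UB},\overline{\mathcal Q}_0^i(x_0^{i+1})\}$. The values of $\mathrm{UB},\mathrm{LB}$ "at the $i$-th iteration" are those after this update. *)

theory Defs
  imports "HOL-Analysis.Analysis"
begin

section \<open>The problem instances\<close>

text \<open>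
  An instance consists of the constants \<open>L\<^sub>t\<close>, the number \<open>K\<^sub>t\<close> of equiprobable nodes of
  stage \<open>t\<close>, the points \<open>w\<^sub>t\<^sub>k\<close> and the values \<open>v\<^sub>t\<^sub>k\<close>. Stages are numbered from 1 to \<open>T\<close>
  and the nodes of stage \<open>t\<close> from 1 to \<open>K\<^sub>t\<close>; all other indices are junk. The state space is
  \<open>cball 0 R\<close> at every stage.
\<close>

record ('n::finite) msp =
  lip :: "nat \<Rightarrow> real"
  nodes :: "nat \<Rightarrow> nat"
  pt :: "nat \<Rightarrow> nat \<Rightarrow> real^'n"
  val :: "nat \<Rightarrow> nat \<Rightarrow> real"

definition F_cost :: "real \<Rightarrow> ('n::finite) msp \<Rightarrow> nat \<Rightarrow> real^'n \<Rightarrow> real" where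
  "F_cost R P t x =
     (if t = 0 then 0
      else Max (insert 0 ((\<lambda>k. val P t k + lip P (t + 1) / R * (pt P t k \<bullet> (x - pt P t k)))
                           ` {1..nodes P t})))"

definition g_cost :: "nat \<Rightarrow> ('n::finite) msp \<Rightarrow> nat \<Rightarrow> nat \<Rightarrow> real^'n \<Rightarrow> real" where
  "g_cost T P t k x = (if t < T then lip P t * norm (x - pt P t k) else 0)"

definition node_cost :: "nat \<Rightarrow> real \<Rightarrow> ('n::finite) msp \<Rightarrow> nat \<Rightarrow> nat \<Rightarrow> real^'n \<Rightarrow> real^'n \<Rightarrow> real"
  where "node_cost T R P t k z x = F_cost R P (t - 1) z + g_cost T P t k x"

definition hard_form :: "nat \<Rightarrow> real \<Rightarrow> real \<Rightarrow> real \<Rightarrow> ('n::finite) msp \<Rightarrow> bool" where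
  "hard_form T R L \<epsilon> P \<longleftrightarrow>
     L / 2 \<le> lip P T \<and> lip P 1 \<le> L \<and> (\<forall>t\<in>{1..<T}. lip P (t + 1) < lip P t) \<and>
     nodes P T = 1 \<and>
     (\<forall>t\<in>{1..T - 1}.
        let d = real CARD('n); \<beta> = \<epsilon> / ((real T - 1) * lip P (t + 1)) in
        (\<forall>k\<in>{1..nodes P t}. norm (pt P t k) = R) \<and>
        (\<forall>k\<in>{1..nodes P t}. \<forall>l\<in>{1..nodes P t}. l \<noteq> k \<longrightarrow>
            (pt P t l - pt P t k) \<bullet> pt P t k < - \<beta> * R) \<and>
        real (nodes P t) \<ge>
          d * (d - 2) * sqrt pi / (d - 1) * (Gamma (d / 2 + 1 / 2) / Gamma (d / 2 + 1))
            * (R / (2 * \<beta>)) powr ((d - 2) / 2) \<and>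
        (\<forall>k\<in>{1..nodes P t}. \<epsilon> / (2 * (real T - 1)) < val P t k \<and> val P t k < \<epsilon> / (real T - 1)))"

text \<open>
  The multistage problem itself. Stage-\<open>T\<close> nodes have the cost \<open>F\<^sub>T\<^sub>-\<^sub>1\<close> of the incoming
  state only, so that the minimum over the (dummy) last state is just that cost. The algorithm
  below sees the problem only through \<open>node_cost\<close>, \<open>nodes\<close> and \<open>lip\<close>.
\<close>

function cost_to_go :: "nat \<Rightarrow> real \<Rightarrow> ('n::finite) msp \<Rightarrow> nat \<Rightarrow> real^'n \<Rightarrow> real" where
  "cost_to_go T R P t x =
     (if t < T then
        (\<Sum>k = 1..nodes P (t + 1).
           INF y\<in>cball 0 R. node_cost T R P (t + 1) k x y + cost_to_go T R P (t + 1) y)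
        / real (nodes P (t + 1))
      else 0)"
  by pat_completeness auto
termination
  by (relation "Wellfounded.measure (\<lambda>(T, R, P, t, x). T - t)") auto

declare cost_to_go.simps [simp del]

definition value_fun :: "nat \<Rightarrow> real \<Rightarrow> ('n::finite) msp \<Rightarrow> nat \<Rightarrow> nat \<Rightarrow> real^'n \<Rightarrow> real" where
  "value_fun T R P t k x = (INF y\<in>cball 0 R. node_cost T R P t k x y + cost_to_go T R P t y)"

definition root_value :: "nat \<Rightarrow> real \<Rightarrow> ('n::finite) msp \<Rightarrow> real" where
  "root_value T R P = (INF x\<in>cball 0 R. cost_to_go T R P 0 x)"


section \<open>Convex biconjugates\<close>

definition conjugate :: "('a::real_inner \<Rightarrow> ereal) \<Rightarrow> 'a \<Rightarrow> ereal" where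
  "conjugate f y = (SUP x. ereal (y \<bullet> x) - f x)"

definition conv_min :: "('a::real_inner \<Rightarrow> ereal) \<Rightarrow> ('a \<Rightarrow> ereal) \<Rightarrow> 'a \<Rightarrow> ereal" where
  "conv_min f h = conjugate (conjugate (\<lambda>x. min (f x) (h x)))"


section \<open>Deterministic sampling dual dynamic programming\<close>

text \<open>
  A trace records everything computed in the iterations. The first argument of each field is
  the iteration; \<open>Qlo i t\<close>, \<open>Qup i t\<close>, \<open>LB i\<close> and \<open>UB i\<close> are the values at the end of
  iteration \<open>i\<close> (the initial values for \<open>i = 0\<close>). \<open>trial i t\<close> is the state \<open>x\<^sub>t\<close> chosen in
  iteration \<open>i\<close>, and \<open>fx\<close>, \<open>fz\<close> are the forward solutions.
\<close>

record ('n::finite) trace =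
  trial :: "nat \<Rightarrow> nat \<Rightarrow> real^'n"
  fx :: "nat \<Rightarrow> nat \<Rightarrow> nat \<Rightarrow> real^'n"
  fz :: "nat \<Rightarrow> nat \<Rightarrow> nat \<Rightarrow> real^'n"
  vlo :: "nat \<Rightarrow> nat \<Rightarrow> nat \<Rightarrow> real"
  dual :: "nat \<Rightarrow> nat \<Rightarrow> nat \<Rightarrow> real^'n"
  vup :: "nat \<Rightarrow> nat \<Rightarrow> nat \<Rightarrow> ereal"
  Qlo :: "nat \<Rightarrow> nat \<Rightarrow> real^'n \<Rightarrow> real"
  Qup :: "nat \<Rightarrow> nat \<Rightarrow> real^'n \<Rightarrow> ereal"
  LB :: "nat \<Rightarrow> real"
  UB :: "nat \<Rightarrow> ereal"

definition initialized :: "nat \<Rightarrow> real \<Rightarrow> ('n::finite) trace \<Rightarrow> bool" where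
  "initialized T R tr \<longleftrightarrow>
     (\<forall>t<T. Qlo tr 0 t = (\<lambda>x. 0) \<and> Qup tr 0 t = (\<lambda>x. \<infinity>)) \<and>
     (\<forall>i. Qlo tr i T = (\<lambda>x. 0) \<and> Qup tr i T = (\<lambda>x. 0)) \<and>
     trial tr 1 0 \<in> cball 0 R \<and> LB tr 0 = 0 \<and> UB tr 0 = \<infinity>"

definition forward_step :: "nat \<Rightarrow> real \<Rightarrow> ('n::finite) msp \<Rightarrow> ('n::finite) trace \<Rightarrow> nat \<Rightarrow> bool" where
  "forward_step T R P tr i \<longleftrightarrow>
     (\<forall>t\<in>{1..T}. \<forall>k\<in>{1..nodes P t}.
        is_arg_min
          (\<lambda>(x, z). node_cost T R P t k z x + lip P t * norm (trial tr i (t - 1) - z)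
                      + Qlo tr (i - 1) t x)
          (\<lambda>(x, z). x \<in> cball 0 R \<and> z \<in> cball 0 R)
          (fx tr i t k, fz tr i t k)) \<and>
     (\<forall>t\<in>{1..T - 1}. \<exists>k.
        is_arg_max (\<lambda>k. Qup tr (i - 1) t (fx tr i t k) - ereal (Qlo tr (i - 1) t (fx tr i t k)))
          (\<lambda>k. k \<in> {1..nodes P t}) k \<and>
        trial tr i t = fx tr i t k)"

definition dual_fun ::
  "nat \<Rightarrow> real \<Rightarrow> ('n::finite) msp \<Rightarrow> nat \<Rightarrow> nat \<Rightarrow> (real^'n \<Rightarrow> real) \<Rightarrow> real^'n \<Rightarrow> real^'n \<Rightarrow> real" where
  "dual_fun T R P t k q y l =
     (INF (x, z)\<in>cball 0 R \<times> cball 0 R. node_cost T R P t k z x + l \<bullet> (y - z) + q x)"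

definition backward_step :: "nat \<Rightarrow> real \<Rightarrow> ('n::finite) msp \<Rightarrow> ('n::finite) trace \<Rightarrow> nat \<Rightarrow> bool" where
  "backward_step T R P tr i \<longleftrightarrow>
     (\<forall>t\<in>{1..T}.
        (\<forall>k\<in>{1..nodes P t}.
           is_arg_max (dual_fun T R P t k (Qlo tr i t) (trial tr i (t - 1)))
             (\<lambda>l. norm l \<le> lip P t) (dual tr i t k) \<and>
           vlo tr i t k =
             dual_fun T R P t k (Qlo tr i t) (trial tr i (t - 1)) (dual tr i t k) \<and>
           vup tr i t k =
             ereal (node_cost T R P t k (fz tr i t k) (fx tr i t k)
                      + lip P t * norm (trial tr i (t - 1) - fz tr i t k))
             + Qup tr i t (fx tr i t k)) \<and>
        Qlo tr i (t - 1) =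
          (\<lambda>x. max (Qlo tr (i - 1) (t - 1) x)
                 ((\<Sum>k = 1..nodes P t. vlo tr i t k - dual tr i t k \<bullet> (trial tr i (t - 1) - x))
                    / real (nodes P t))) \<and>
        Qup tr i (t - 1) =
          conv_min (Qup tr (i - 1) (t - 1))
            (\<lambda>x. (\<Sum>k = 1..nodes P t.
                     vup tr i t k + ereal (lip P t * norm (x - trial tr i (t - 1))))
                   / ereal (real (nodes P t))))"

definition root_step :: "real \<Rightarrow> ('n::finite) trace \<Rightarrow> nat \<Rightarrow> bool" where
  "root_step R tr i \<longleftrightarrow>
     is_arg_min (Qlo tr i 0) (\<lambda>x. x \<in> cball 0 R) (trial tr (i + 1) 0) \<and>
     LB tr i = Qlo tr i 0 (trial tr (i + 1) 0) \<and>
     UB tr i = min (UB tr (i - 1)) (Qup tr i 0 (trial tr (i + 1) 0))"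

text \<open>
  \<open>algorithm_run T R \<epsilon> P tr N\<close>: the algorithm can perform the iterations \<open>1, \<dots>, N\<close> (it has not
  stopped before iteration \<open>N\<close>) with all choices as recorded in \<open>tr\<close>. Entries of the trace
  for later iterations are unconstrained.
\<close>

definition algorithm_run ::
  "nat \<Rightarrow> real \<Rightarrow> real \<Rightarrow> ('n::finite) msp \<Rightarrow> ('n::finite) trace \<Rightarrow> nat \<Rightarrow> bool" where
  "algorithm_run T R \<epsilon> P tr N \<longleftrightarrow>
     initialized T R tr \<and>
     (\<forall>i\<in>{1..N}.
        UB tr (i - 1) - ereal (LB tr (i - 1)) > ereal \<epsilon> \<and>
        forward_step T R P tr i \<and> backward_step T R P tr i \<and> root_step R tr i)"

end

theory Submission
  imports Defs
begin

text \<open>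
  The nodes \<open>w\<^sub>t\<^sub>k\<close> come from a maximal spherical code of cosine \<open>1 - \<beta>\<^sub>t / R\<close>: by maximality
  the caps around its points cover the sphere, so the cones over these caps cover the unit ball,
  and comparing volumes bounds the number of points from below.

  Since \<open>L\<^sub>t > L\<^sub>t\<^sub>+\<^sub>1\<close>, the forward problem at node \<open>(t, k)\<close> returns \<open>w\<^sub>t\<^sub>k\<close>, so every iteration visits a
  single point of each stage. The optimal dual solution at a visited point \<open>w\<^sub>t\<^sub>l\<close> is forced to be
  \<open>(L\<^sub>t\<^sub>+\<^sub>1 / R) w\<^sub>t\<^sub>l\<close>, hence the cut generated there contributes nothing at the other points. The
  upper cones generated at visited points lie above an affine function with slope
  \<open>(L\<^sub>t\<^sub>+\<^sub>1 / R) w\<^sub>t\<^sub>k\<close> and value \<open>3 \<epsilon> / (2 (T - 1))\<close> (plus the later stages) at an unvisited point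
  \<open>w\<^sub>t\<^sub>k\<close>, and so does their convexification. Each stage therefore contributes
  to the gap at least \<open>3 \<epsilon> / (2 (T - 1))\<close> times the fraction of its unvisited nodes, and the gap is at
  least \<open>\<epsilon>\<close> as long as at most a third of the nodes of every stage is visited.
\<close>

section \<open>Volumes of spherical sectors\<close>

lemma nn_integral_lborel_shift:
  fixes f :: "'a::euclidean_space \<Rightarrow> ennreal"
  assumes "f \<in> borel_measurable borel"
  shows "(\<integral>\<^sup>+x. f (a + x) \<partial>lborel) = (\<integral>\<^sup>+x. f x \<partial>lborel)"
proof -
  have "(\<integral>\<^sup>+x. f x \<partial>lborel) = (\<integral>\<^sup>+x. f x \<partial>distr lborel borel ((+) a))"
    by (simp add: lborel_distr_plus)
  also have "\<dots> = (\<integral>\<^sup>+x. f (a + x) \<partial>lborel)"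
    using assms by (subst nn_integral_distr) auto
  finally show ?thesis ..
qed

lemma nn_integral_lborel_reflect:
  fixes f :: "'a::euclidean_space \<Rightarrow> ennreal"
  assumes "f \<in> borel_measurable borel"
  shows "(\<integral>\<^sup>+x. f (a - x) \<partial>lborel) = (\<integral>\<^sup>+x. f x \<partial>lborel)"
proof -
  have "(\<integral>\<^sup>+x. f x \<partial>lborel) = (\<integral>\<^sup>+x. f x \<partial>distr lborel borel (\<lambda>x. a - x))"
    using lborel_affine[of "-1" a] by (simp add: density_1)
  also have "\<dots> = (\<integral>\<^sup>+x. f (a - x) \<partial>lborel)"
    using assms by (subst nn_integral_distr) auto
  finally show ?thesis ..
qed

text \<open>
  The library has this only for index types of class \<^class>\<open>wellorder\<close>. Here it follows from Fubini:
  shifting both variables turns \<open>\<lambda>(f\<^sup>-\<^sup>1 A) \<lambda>(B)\<close> into \<open>\<lambda>(A) \<lambda>(f\<^sup>-\<^sup>1 B)\<close>, and the unit ball \<open>B\<close>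
  satisfies \<open>f\<^sup>-\<^sup>1 B = B\<close>.
\<close>
lemma emeasure_orthogonal_vimage:
  fixes f :: "real^'n \<Rightarrow> real^'n"
  assumes f: "orthogonal_transformation f" and A [measurable]: "A \<in> sets borel"
  shows "emeasure lborel (f -` A) = emeasure lborel A"
proof -
  define B where "B = (cball 0 1 :: (real^'n) set)"
  have [measurable]: "B \<in> sets borel"
    by (simp add: B_def)
  have lin: "linear f"
    using f by (simp add: orthogonal_transformation_linear)
  then have cont: "continuous_on UNIV f"
    by (simp add: linear_continuous_on linear_linear)
  then have [measurable]: "f \<in> borel_measurable borel"
    by (rule borel_measurable_continuous_onI)
  have B: "f -` B = B"
    using f by (auto simp: B_def orthogonal_transformation_norm)
  \<comment> \<open>A right inverse of \<open>f\<close>: replacing \<open>x\<close> by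
    \<open>x - g y\<close> turns \<open>f x\<close> into \<open>f x - y\<close>.\<close>
  obtain g where g: "f (g y) = y" for y
    using orthogonal_transformation_surj[OF f] by (metis surjD)
  have "emeasure lborel (f -` A) * emeasure lborel B
      = (\<integral>\<^sup>+x. indicator A (f x) * emeasure lborel B \<partial>lborel)"
  proof -
    have "emeasure lborel (f -` A) = (\<integral>\<^sup>+x. indicator (f -` A) x \<partial>lborel)"
      using measurable_sets_borel[of f borel A] by (subst nn_integral_indicator) auto
    also have "\<dots> = (\<integral>\<^sup>+x. indicator A (f x) \<partial>lborel)"
      by (intro nn_integral_cong) (simp add: indicator_def)
    finally show ?thesis
      by (simp add: nn_integral_multc)
  qed
  also have "\<dots> = (\<integral>\<^sup>+x. (\<integral>\<^sup>+y. indicator A (f x) * indicator B (f x + y) \<partial>lborel) \<partial>lborel)"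
    by (intro nn_integral_cong) (simp add: nn_integral_cmult nn_integral_lborel_shift)
  also have "\<dots> = (\<integral>\<^sup>+y. (\<integral>\<^sup>+x. indicator A (f x) * indicator B (f x + y) \<partial>lborel) \<partial>lborel)"
    by (rule lborel_pair.Fubini') measurable
  also have "\<dots> = (\<integral>\<^sup>+y. (\<integral>\<^sup>+x. indicator A (f x - y) * indicator B (f x) \<partial>lborel) \<partial>lborel)"
  proof (rule nn_integral_cong)
    fix y :: "real^'n"
    have "(\<integral>\<^sup>+x. indicator A (f x) * indicator B (f x + y) \<partial>lborel)
        = (\<integral>\<^sup>+x. indicator A (f (- g y + x)) * indicator B (f (- g y + x) + y) \<partial>lborel)"
      by (rule nn_integral_lborel_shift[symmetric]) measurable
    moreover have "f (- g y + x) = f x - y" for x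
      using g[of y] linear_diff[OF lin, of x "g y"] by simp
    ultimately show "(\<integral>\<^sup>+x. indicator A (f x) * indicator B (f x + y) \<partial>lborel)
        = (\<integral>\<^sup>+x. indicator A (f x - y) * indicator B (f x) \<partial>lborel)"
      by simp
  qed
  also have "\<dots> = (\<integral>\<^sup>+x. (\<integral>\<^sup>+y. indicator A (f x - y) * indicator B (f x) \<partial>lborel) \<partial>lborel)"
    by (rule lborel_pair.Fubini') measurable
  also have "\<dots> = (\<integral>\<^sup>+x. emeasure lborel A * indicator B x \<partial>lborel)"
  proof (intro nn_integral_cong)
    fix x :: "real^'n"
    have "indicator B (f x) = (indicator B x :: ennreal)"
      using B by (auto simp: indicator_def)
    then show "(\<integral>\<^sup>+y. indicator A (f x - y) * indicator B (f x) \<partial>lborel)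
        = emeasure lborel A * indicator B x"
      by (simp add: nn_integral_multc nn_integral_lborel_reflect)
  qed
  also have "\<dots> = emeasure lborel A * emeasure lborel B"
    by (simp add: nn_integral_cmult)
  finally have "emeasure lborel (f -` A) * emeasure lborel B = emeasure lborel A * emeasure lborel B" .
  moreover have "emeasure lborel B \<noteq> 0" "emeasure lborel B \<noteq> top"
    by (simp_all add: B_def emeasure_cball unit_ball_vol_pos[THEN less_imp_neq, symmetric])
  ultimately show ?thesis
    by (metis ennreal_mult_cancel_left mult.commute)
qed

text \<open>
  Up to the factor \<^term>\<open>unit_ball_vol n\<close>, the left-hand side is the volume of the sector
  \<open>x\<^sub>1 \<ge> c \<parallel>x\<parallel>\<close> of the unit ball in dimension \<open>n + 1\<close>: the cone below height \<open>c\<close> and the cap above.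
\<close>
lemma cap_integral_bound:
  fixes c :: real
  assumes n: "n \<ge> 2" and c: "0 \<le> c" "c < 1"
  defines "h \<equiv> \<lambda>y. sqrt (1 - y\<^sup>2) ^ n"
  shows "c * h c / (n + 1) + integral {c..1} h
      \<le> n / ((n + 1) * (real n - 1)) * sqrt (2 * (1 - c)) ^ (n - 1)"
proof (cases "n = 2")
  \<comment> \<open>The pointwise comparison used for \<open>n \<ge> 3\<close> would read
    \<open>1 \<le> 1 / r y\<close> here, which fails for \<open>y < 1 / 2\<close>, so this case is
    integrated explicitly.\<close>
  case True
  have h: "h y = 1 - y\<^sup>2" if "y \<in> {c..1}" for y
    using that c by (simp add: h_def True abs_square_le_1)
  have "((\<lambda>y. 1 - y\<^sup>2) has_integral (1 - 1^3/3) - (c - c^3/3)) {c..1}"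
    using c by (intro fundamental_theorem_of_calculus)
      (auto intro!: derivative_eq_intros simp: has_real_derivative_iff_has_vector_derivative [symmetric])
  then have "(h has_integral (1 - 1^3/3) - (c - c^3/3)) {c..1}"
    by (rule has_integral_eq[rotated]) (simp add: h)
  then have "c * h c / (n + 1) + integral {c..1} h = 2 / 3 * (1 - c)"
    using c h[of c] by (simp add: integral_unique True) (simp add: field_simps power2_eq_square power3_eq_cube)
  also have "1 - c \<le> sqrt (2 * (1 - c))"
  proof (rule real_le_rsqrt)
    have "(1 - c) * (1 - c) \<le> 2 * (1 - c)"
      using c by (intro mult_right_mono) auto
    then show "(1 - c)\<^sup>2 \<le> 2 * (1 - c)" by (simp add: power2_eq_square)
  qed
  finally show ?thesis by (simp add: True)
next
  case False
  with n have n3: "n \<ge> 3" by simp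
  define s where "s y = sqrt (1 - y\<^sup>2)" for y :: real
  define r where "r y = sqrt (2 * (1 - y))" for y :: real
  \<comment> \<open>\<open>H 1 = 0\<close>, and \<open>- H c\<close> is the right-hand side minus
    the cone term, so the claim is \<open>integral {c..1} h \<le> H 1 - H c\<close>. It follows from
    \<open>h \<le> H'\<close>, which for \<open>y < 1\<close> amounts to
    \<open>s ^ (n - 2) \<le> r ^ (n - 3)\<close> and holds because \<open>s \<le> 1\<close> and
    \<open>s \<le> r\<close>.\<close>
  define H where "H y = y * s y ^ n / (n + 1) - n / ((n + 1) * (real n - 1)) * r y ^ (n - 1)" for y
  define H' where "H' y = s y ^ n + n / (n + 1) * (r y ^ (n - 2) / r y - s y ^ (n - 2))" for y
  have "(H has_real_derivative H' y) (at y)" if "y \<in> {c<..<1}" for y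
  proof -
    have y: "0 \<le> y" "y < 1" "y\<^sup>2 < 1" using that c by (auto simp: abs_square_less_1)
    have pos: "s y > 0" "r y > 0" "(s y)\<^sup>2 = 1 - y\<^sup>2"
      using y by (auto simp: s_def r_def)
    have s': "(s has_real_derivative - y / s y) (at y)"
      unfolding s_def using y by (auto intro!: derivative_eq_intros simp: field_simps)
    have r': "(r has_real_derivative - 1 / r y) (at y)"
      unfolding r_def using y by (auto intro!: derivative_eq_intros simp: field_simps)
    obtain m where m: "n = Suc (Suc m)"
      using n by (metis less_eqE numeral_2_eq_2 add_Suc)
    have d1: "((\<lambda>y. y * s y ^ n) has_real_derivative 1 * s y ^ n + n * s y ^ (n - 1) * (- y / s y) * y) (at y)"
      by (auto intro!: derivative_eq_intros s')
    have "n * s y ^ (n - 1) * (- y / s y) * y = - n * s y ^ m * y\<^sup>2"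
      using pos by (simp add: m field_simps power2_eq_square)
    also have "\<dots> = - n * s y ^ m * (1 - (s y)\<^sup>2)" using pos by simp
    also have "\<dots> = n * s y ^ n - n * s y ^ m"
      by (simp add: m algebra_simps power2_eq_square)
    finally have d1': "n * s y ^ (n - 1) * (- y / s y) * y = n * s y ^ n - n * s y ^ m" .
    have d2: "((\<lambda>y. r y ^ (n - 1)) has_real_derivative (real n - 1) * r y ^ m * (- 1 / r y)) (at y)"
      using DERIV_power[OF r', of "n - 1"] by (simp add: m mult_ac)
    have "(H has_real_derivative (s y ^ n + (n * s y ^ n - n * s y ^ m)) / (n + 1)
        - n / ((n + 1) * (real n - 1)) * ((real n - 1) * r y ^ m * (- 1 / r y))) (at y)"
      unfolding H_def
      by (intro DERIV_diff DERIV_cdivide DERIV_cmult d2) (use d1 in \<open>simp only: d1' mult_1\<close>)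
    also have "(s y ^ n + (n * s y ^ n - n * s y ^ m)) / (n + 1)
        - n / ((n + 1) * (real n - 1)) * ((real n - 1) * r y ^ m * (- 1 / r y)) = H' y"
    proof -
      have "(real n - 1) \<noteq> 0" using n by simp
      moreover have "real n + 1 \<noteq> 0" by simp
      moreover have "n - 2 = m" by (simp add: m)
      moreover have "r y \<noteq> 0" using pos by simp
      ultimately show ?thesis
        unfolding H'_def by (simp add: divide_simps) (simp add: algebra_simps)
    qed
    finally show ?thesis .
  qed
  moreover have "continuous_on {c..1} H"
    unfolding H_def s_def r_def by (intro continuous_intros) auto
  ultimately have H: "(H' has_integral H 1 - H c) {c..1}"
    using c by (intro fundamental_theorem_of_calculus_interior)
      (auto simp: has_real_derivative_iff_has_vector_derivative [symmetric])
  have h: "h integrable_on {c..1}"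
    unfolding h_def by (intro integrable_continuous_real continuous_intros)
  have "integral {c..1} h \<le> H 1 - H c"
  proof (rule has_integral_le[OF integrable_integral[OF h] H])
    fix y assume y: "y \<in> {c..1}"
    show "h y \<le> H' y"
    proof (cases "y = 1")
      \<comment> \<open>Here \<open>r y = 0\<close>, so the quotient in \<open>H'\<close> is 0 by
        the convention on division by zero.\<close>
      case True
      then show ?thesis using n3 by (simp add: h_def H'_def s_def r_def zero_power)
    next
      case False
      with y c have y: "0 \<le> y" "y < 1" by auto
      have pos: "s y \<ge> 0" "r y > 0" using y by (auto simp: s_def r_def abs_square_le_1)
      have s1: "s y \<le> 1" by (simp add: s_def)
      have "(1 + y) * (1 - y) \<le> 2 * (1 - y)"
        using y by (intro mult_right_mono) auto
      then have sr: "s y \<le> r y"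
        by (simp add: s_def r_def algebra_simps power2_eq_square)
      obtain m where m: "n = Suc (Suc (Suc m))"
        using n3 by (metis less_eqE numeral_3_eq_3 add_Suc)
      have "s y ^ Suc m * r y \<le> (1 * r y ^ m) * r y"
        using mult_mono[OF s1 power_mono[OF sr pos(1), of m]] pos by simp
      then have "s y ^ (n - 2) \<le> r y ^ (n - 2) / r y"
        using pos by (simp add: m field_simps)
      then show ?thesis by (simp add: h_def H'_def s_def)
    qed
  qed
  then show ?thesis
    using n3 by (simp add: H_def h_def s_def r_def zero_power add.commute)
qed

section \<open>Sectors of the unit ball and covers of the sphere\<close>

text \<open>For a unit vector \<open>w\<close>, the directions at an angle of cosine at least
  \<open>c\<close> to \<open>w\<close>. Multiplying by \<open>norm x\<close> instead of normalizing
  \<open>x\<close> includes the origin.\<close>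

definition cone_sector :: "real \<Rightarrow> 'a::real_inner \<Rightarrow> 'a set" where
  "cone_sector c w = {x. norm x \<le> 1 \<and> c * norm x \<le> x \<bullet> w}"

lemma cone_sector_borel [measurable]: "cone_sector c w \<in> sets borel"
  unfolding cone_sector_def
  by (intro borel_closed closed_Collect_conj closed_Collect_le continuous_intros)

text \<open>An orthogonal map carrying \<open>v\<close> to \<open>w\<close> carries one sector to
  the other, so a sector around a basis vector is the only one to be measured.\<close>

lemma emeasure_cone_sector_rotate:
  fixes v w :: "real^'n"
  assumes "norm v = norm w"
  shows "emeasure lborel (cone_sector c v) = emeasure lborel (cone_sector c w)"
proof -
  obtain f where f: "orthogonal_transformation f" "f v = w"
    using orthogonal_transformation_exists[OF assms] by blast
  have "f x \<bullet> w = x \<bullet> v" for x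
    using f by (metis orthogonal_transformation_def)
  then have "f -` cone_sector c w = cone_sector c v"
    using f(1) by (auto simp: cone_sector_def orthogonal_transformation_norm)
  then show ?thesis
    using emeasure_orthogonal_vimage[OF f(1), of "cone_sector c w"] by simp
qed

text \<open>Fubini along \<open>b\<close>: the slice at height \<open>y\<close> lies in an
  \<open>n\<close>-dimensional ball, limited by the cone below height \<open>c\<close> and by the
  sphere above. Integrating these balls gives the left-hand side of
  \<open>cap_integral_bound\<close>.\<close>

lemma emeasure_cone_sector_le:
  fixes b :: "'a::euclidean_space"
  assumes b: "b \<in> Basis" and c: "0 \<le> c" "c < 1" and d: "DIM('a) \<ge> 3"
  defines "n \<equiv> DIM('a) - 1"
  shows "emeasure lborel (cone_sector c b)
    \<le> ennreal (unit_ball_vol n * (n / ((real n + 1) * (real n - 1)) * sqrt (2 * (1 - c)) ^ (n - 1)))"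
proof -
  interpret product_sigma_finite "\<lambda>_. lborel :: real measure"
    by standard
  define A where "A = (Basis - {b} :: 'a set)"
  have A: "finite A" "b \<notin> A" "insert b A = Basis" "card A = n"
    using b by (auto simp: A_def n_def)
  define P where "P = (\<lambda>I. Pi\<^sub>M I (\<lambda>_::'a. lborel :: real measure))"
  \<comment> \<open>the slice of the sector at height \<open>y\<close> is contained in a ball of radius \<open>rad y\<close>\<close>
  define rad where "rad y = (if y < c then y * sqrt (1 - c\<^sup>2) / c else sqrt (1 - y\<^sup>2))" for y
  define S where "S = {f. sqrt (\<Sum>i\<in>Basis. (f i)\<^sup>2) \<le> 1 \<and> c * sqrt (\<Sum>i\<in>Basis. (f i)\<^sup>2) \<le> f b} \<inter> space (P Basis)"
  define D where "D y = {f. sqrt (\<Sum>i\<in>A. (f i)\<^sup>2) \<le> rad y} \<inter> space (P A)" for y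
  have [measurable]: "S \<in> sets (P Basis)"
  proof -
    have comp: "(\<lambda>f. f i) \<in> borel_measurable (P Basis)" if "i \<in> Basis" for i
      unfolding P_def using that measurable_component_singleton[of i Basis "\<lambda>_. lborel"] by simp
    define N where "N f = sqrt (\<Sum>i\<in>Basis. (f i)\<^sup>2)" for f :: "'a \<Rightarrow> real"
    have "(\<lambda>f. \<Sum>i\<in>Basis. (f i)\<^sup>2) \<in> borel_measurable (P Basis)"
      by (intro borel_measurable_sum borel_measurable_power comp)
    from measurable_compose[OF this, of sqrt borel] have N: "N \<in> borel_measurable (P Basis)"
      unfolding N_def by simp
    have "S = {f \<in> space (P Basis). N f \<le> 1 \<and> c * N f \<le> f b}"
      by (auto simp: S_def N_def)
    also have "\<dots> \<in> sets (P Basis)"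
      by (intro sets.sets_Collect_conj borel_measurable_le borel_measurable_times
          borel_measurable_const comp[OF b] N)
    finally show ?thesis .
  qed
  have [measurable]: "D y \<in> sets (P A)" for y
    unfolding D_def P_def by measurable
  have "(lborel :: 'a measure) = distr (P Basis) borel (\<lambda>f. \<Sum>b\<in>Basis. f b *\<^sub>R b)"
    unfolding P_def by (rule lborel_eq)
  also have "emeasure \<dots> (cone_sector c b) = emeasure (P Basis)
      ((\<lambda>f. \<Sum>b\<in>Basis. f b *\<^sub>R b) -` cone_sector c b \<inter> space (P Basis))"
    unfolding P_def by (subst emeasure_distr) auto
  also have "(\<lambda>f. \<Sum>b\<in>Basis. f b *\<^sub>R b) -` cone_sector c b \<inter> space (P Basis) = S"
  proof -
    have "norm (\<Sum>b\<in>Basis. f b *\<^sub>R b :: 'a) = sqrt (\<Sum>i\<in>Basis. (f i)\<^sup>2)" for f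
      using euclidean_dist_l2[of 0 "\<Sum>b\<in>Basis. f b *\<^sub>R b :: 'a"] by (simp add: L2_set_def)
    then show ?thesis
      using b by (auto simp: cone_sector_def S_def)
  qed
  also have "emeasure (P Basis) S = (\<integral>\<^sup>+f. indicator S f \<partial>P (insert b A))"
    by (simp add: A)
  also have "\<dots> = (\<integral>\<^sup>+y. \<integral>\<^sup>+f. indicator S (f(b := y)) \<partial>P A \<partial>lborel)"
  proof -
    have "(indicator S :: _ \<Rightarrow> ennreal) \<in> borel_measurable (P (insert b A))"
      using A(3) by simp
    then show ?thesis
      unfolding P_def using A by (subst product_nn_integral_insert_rev) auto
  qed
  also have "\<dots> \<le> (\<integral>\<^sup>+y. \<integral>\<^sup>+f. indicator {0..1} y * indicator (D y) f \<partial>P A \<partial>lborel)"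
  proof (intro nn_integral_mono)
    fix y f assume f: "f \<in> space (P A)"
    define q where "q = (\<Sum>i\<in>A. (f i)\<^sup>2)"
    have q0: "q \<ge> 0" by (simp add: q_def sum_nonneg)
    have "(\<Sum>i\<in>A. ((f(b := y)) i)\<^sup>2) = q"
      unfolding q_def using A(2) by (intro sum.cong) auto
    then have "(\<Sum>i\<in>insert b A. ((f(b := y)) i)\<^sup>2) = y\<^sup>2 + q"
      using A(1,2) by simp
    then have "(\<Sum>i\<in>Basis. ((f(b := y)) i)\<^sup>2) = y\<^sup>2 + q"
      by (simp only: A(3))
    moreover have "y \<in> {0..1} \<and> sqrt q \<le> rad y" if le1: "sqrt (y\<^sup>2 + q) \<le> 1" and le: "c * sqrt (y\<^sup>2 + q) \<le> y"
    proof -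
      have "0 \<le> c * sqrt (y\<^sup>2 + q)" using c q0 by simp
      with le have y0: "0 \<le> y" by linarith
      from le1 have le1': "y\<^sup>2 + q \<le> 1" by simp
      with q0 have "y\<^sup>2 \<le> 1" by linarith
      with y0 have y1: "y \<le> 1" by (simp add: power_le_one_iff)
      have "sqrt q \<le> rad y"
      proof (cases "y < c")
        case True
        with y0 have c0: "c > 0" by linarith
        have "(c * sqrt (y\<^sup>2 + q))\<^sup>2 \<le> y\<^sup>2"
          using le c q0 by (intro power_mono) auto
        then have "c\<^sup>2 * q \<le> y\<^sup>2 * (1 - c\<^sup>2)"
          using q0 by (simp add: power_mult_distrib algebra_simps)
        then have "sqrt (c\<^sup>2 * q) \<le> sqrt (y\<^sup>2 * (1 - c\<^sup>2))"
          by simp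
        then have "c * sqrt q \<le> y * sqrt (1 - c\<^sup>2)"
          using c y0 by (simp add: real_sqrt_mult)
        then show ?thesis using True c0 by (simp add: rad_def field_simps)
      next
        case False
        then show ?thesis using le1' by (simp add: rad_def)
      qed
      with y0 y1 show ?thesis by simp
    qed
    ultimately show "indicator S (f(b := y)) \<le> (indicator {0..1} y * indicator (D y) f :: ennreal)"
      using f by (auto simp: S_def D_def q_def indicator_def)
  qed
  also have "\<dots> = (\<integral>\<^sup>+y. indicator {0..1} y * emeasure (P A) (D y) \<partial>lborel)"
    by (intro nn_integral_cong) (simp add: nn_integral_cmult)
  also have "\<dots> = (\<integral>\<^sup>+y. ennreal (unit_ball_vol n * rad y ^ n) * indicator {0..1} y \<partial>lborel)"
  proof (rule nn_integral_cong_AE)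
    \<comment> \<open>The ball volume formula is applied at positive radius; within
      \<open>{0..1}\<close> the radius can vanish only at the end points.\<close>
    have "AE y::real in lborel. y \<notin> {0, 1}"
      by (intro AE_not_in countable_imp_null_set_lborel) auto
    then show "AE y in lborel. indicator {0..1} y * emeasure (P A) (D y)
        = ennreal (unit_ball_vol n * rad y ^ n) * indicator {0..1} y"
    proof eventually_elim
      case (elim y)
      show ?case
      proof (cases "y \<in> {0<..<1}")
        case True
        have "rad y > 0" using True c by (auto simp: rad_def abs_square_less_1)
        then show ?thesis
          using emeasure_cball_aux[OF A(1), of "rad y"] True by (simp add: D_def P_def A)
      qed (use elim in \<open>auto simp: indicator_def\<close>)
    qed
  qed
  also have "\<dots> = ennreal (unit_ball_vol n * (c * sqrt (1 - c\<^sup>2) ^ n / (n + 1)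
      + integral {c..1} (\<lambda>y. sqrt (1 - y\<^sup>2) ^ n)))"
  proof -
    have n: "n > 0" using d by (simp add: n_def)
    have "((\<lambda>y. y ^ (n + 1) / (n + 1)) has_real_derivative y ^ n) (at y within {0..c})" for y
      using DERIV_cdivide[OF DERIV_pow[of "n + 1" y "{0..c}"], of "real (n + 1)"] by simp
    then have "((\<lambda>y. y ^ n) has_integral c ^ (n + 1) / (n + 1) - 0 ^ (n + 1) / (n + 1)) {0..c}"
      using c by (intro fundamental_theorem_of_calculus)
        (auto simp: has_real_derivative_iff_has_vector_derivative [symmetric])
    from has_integral_mult_right[OF this, of "(sqrt (1 - c\<^sup>2) / c) ^ n"]
    have lin: "((\<lambda>y. (sqrt (1 - c\<^sup>2) / c) ^ n * y ^ n) has_integral c * sqrt (1 - c\<^sup>2) ^ n / (n + 1)) {0..c}"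
      using c n by (cases "c = 0") (simp_all add: power_divide mult.commute)
    have "(sqrt (1 - c\<^sup>2) / c) ^ n * y ^ n = rad y ^ n" if "y \<in> {0..c}" "c \<noteq> 0" for y
      using that c n by (cases "y = c") (auto simp: rad_def power_mult_distrib power_divide)
    from has_integral_eq[OF this lin] have "((\<lambda>y. rad y ^ n) has_integral c * sqrt (1 - c\<^sup>2) ^ n / (n + 1)) {0..c}"
      if "c \<noteq> 0"
      using that by simp
    \<comment> \<open>For \<open>c = 0\<close> the interval is a single point and the integral is
      0.\<close>
    then have "((\<lambda>y. rad y ^ n) has_integral c * sqrt (1 - c\<^sup>2) ^ n / (n + 1)) {0..c}"
      using has_integral_refl(2)[of "\<lambda>y. rad y ^ n" 0] by (cases "c = 0") simp_all
    moreover have "((\<lambda>y. rad y ^ n) has_integral integral {c..1} (\<lambda>y. sqrt (1 - y\<^sup>2) ^ n)) {c..1}"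
    proof (rule has_integral_eq[OF _ integrable_integral])
      show "(\<lambda>y. sqrt (1 - y\<^sup>2) ^ n) integrable_on {c..1}"
        by (intro integrable_continuous_real continuous_intros)
    qed (auto simp: rad_def)
    ultimately have "((\<lambda>y. rad y ^ n) has_integral c * sqrt (1 - c\<^sup>2) ^ n / (n + 1)
        + integral {c..1} (\<lambda>y. sqrt (1 - y\<^sup>2) ^ n)) {0..1}"
      using c by (intro has_integral_combine[where c = c]) auto
    then have *: "((\<lambda>y. unit_ball_vol n * rad y ^ n) has_integral unit_ball_vol n *
        (c * sqrt (1 - c\<^sup>2) ^ n / (n + 1) + integral {c..1} (\<lambda>y. sqrt (1 - y\<^sup>2) ^ n))) {0..1}"
      by (rule has_integral_mult_right)
    have "0 \<le> unit_ball_vol n * rad y ^ n" if "y \<in> {0..1}" for y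
      using that c by (auto simp: rad_def abs_square_le_1)
    note nn_integral_has_integral_lebesgue[OF this *]
    moreover have "(\<integral>\<^sup>+y. ennreal (unit_ball_vol n * rad y ^ n) * indicator {0..1} y \<partial>lborel)
        = (\<integral>\<^sup>+y. ennreal (indicator {0..1} y * (unit_ball_vol n * rad y ^ n)) \<partial>lborel)"
      by (intro nn_integral_cong) (simp add: indicator_def)
    ultimately show ?thesis
      by (simp add: mult.commute)
  qed
  also have "\<dots> \<le> ennreal (unit_ball_vol n * (n / ((real n + 1) * (real n - 1)) * sqrt (2 * (1 - c)) ^ (n - 1)))"
    using cap_integral_bound[of n c] c d by (intro ennreal_leI mult_left_mono) (auto simp: n_def)
  finally show ?thesis .
qed

text \<open>By scaling, the sectors around \<open>S\<close> cover the unit ball. Subadditivity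
  bounds its volume by \<open>card S\<close> times the bound \<open>V\<close> for one sector, and
  the claim is this inequality rearranged.\<close>

lemma card_spherical_cover:
  fixes S :: "(real^'n) set"
  assumes S: "finite S" "\<And>w. w \<in> S \<Longrightarrow> norm w = 1"
    and cover: "\<And>x. norm x = 1 \<Longrightarrow> \<exists>w\<in>S. c \<le> x \<bullet> w"
    and c: "0 \<le> c" "c < 1" and d: "CARD('n) \<ge> 3"
  defines "d \<equiv> real CARD('n)"
  shows "d * (d - 2) / (d - 1) * (unit_ball_vol d / unit_ball_vol (d - 1))
      \<le> real (card S) * sqrt (2 * (1 - c)) ^ (CARD('n) - 2)"
proof -
  define V where "V = unit_ball_vol (d - 1) * ((d - 1) / (d * (d - 2)) * sqrt (2 * (1 - c)) ^ (CARD('n) - 2))"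
  have V: "emeasure lborel (cone_sector c w) \<le> ennreal V" if "norm w = 1" for w :: "real^'n"
  proof -
    obtain b :: "real^'n" where b: "b \<in> Basis" by (meson nonempty_Basis ex_in_conv)
    have "emeasure lborel (cone_sector c w) = emeasure lborel (cone_sector c b)"
      using that b by (intro emeasure_cone_sector_rotate) simp
    also have "\<dots> \<le> ennreal V"
      using emeasure_cone_sector_le[OF b c] d
      by (simp add: V_def d_def of_nat_diff numeral_2_eq_2)
    finally show ?thesis .
  qed
  have "ennreal (unit_ball_vol d) = emeasure lborel (cball 0 1 :: (real^'n) set)"
    by (simp add: emeasure_cball d_def)
  also have "\<dots> \<le> emeasure lborel (\<Union>w\<in>S. cone_sector c w)"
  proof (rule emeasure_mono)
    show "cball 0 1 \<subseteq> (\<Union>w\<in>S. cone_sector c w)"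
    proof
      fix x :: "real^'n" assume x: "x \<in> cball 0 1"
      show "x \<in> (\<Union>w\<in>S. cone_sector c w)"
      proof (cases "x = 0")
        case True
        \<comment> \<open>The origin lies in every sector; covering some unit vector shows that
          there is one.\<close>
        obtain b :: "real^'n" where "b \<in> Basis" by (meson nonempty_Basis ex_in_conv)
        then obtain w where "w \<in> S" using cover[of b] by auto
        then show ?thesis using True by (auto simp: cone_sector_def)
      next
        case False
        then obtain w where w: "w \<in> S" "c \<le> (x /\<^sub>R norm x) \<bullet> w"
          using cover[of "x /\<^sub>R norm x"] by auto
        then have "c * norm x \<le> x \<bullet> w" using False by (simp add: field_simps)
        then show ?thesis using w x by (auto simp: cone_sector_def)
      qed
    qed
  qed (use S in auto)
  also have "\<dots> \<le> (\<Sum>w\<in>S. emeasure lborel (cone_sector c w))"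
    by (intro emeasure_subadditive_finite S) auto
  also have "\<dots> \<le> (\<Sum>w\<in>S. ennreal V)"
    by (intro sum_mono V S)
  also have "\<dots> = ennreal (real (card S) * V)"
    by (simp add: ennreal_mult' ennreal_of_nat_eq_real_of_nat)
  finally have le: "unit_ball_vol d \<le> real (card S) * V"
    using d c by (subst (asm) ennreal_le_iff) (auto simp: V_def d_def)
  have pos: "d > 2" "unit_ball_vol (d - 1) > 0" "unit_ball_vol d > 0"
    using d by (auto simp: d_def)
  have "d * (d - 2) / (d - 1) * (unit_ball_vol d / unit_ball_vol (d - 1))
      \<le> d * (d - 2) / (d - 1) * (real (card S) * V / unit_ball_vol (d - 1))"
    using pos le by (intro mult_left_mono divide_right_mono) auto
  also have "\<dots> = real (card S) * sqrt (2 * (1 - c)) ^ (CARD('n) - 2)"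
    using pos(1) by (simp add: V_def unit_ball_vol_pos[THEN less_imp_neq, symmetric])
  finally show ?thesis .
qed

section \<open>Spherical codes\<close>

text \<open>For \<open>c \<ge> 0\<close> a code of greatest cardinality is a cover, since an
  uncovered unit vector could be added to it. A negative \<open>c\<close> is outside the range of
  the volume bound and is settled by explicit codes.\<close>

lemma spherical_code_exists:
  fixes c :: real
  assumes c: "c < 1" and d: "CARD('n::finite) \<ge> 3"
  defines "d \<equiv> real CARD('n)"
  shows "\<exists>S :: (real^'n) set. finite S \<and> (\<forall>w\<in>S. norm w = 1) \<and>
    (\<forall>v\<in>S. \<forall>w\<in>S. v \<noteq> w \<longrightarrow> v \<bullet> w < c) \<and>
    d * (d - 2) / (d - 1) * (unit_ball_vol d / unit_ball_vol (d - 1))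
      \<le> real (card S) * sqrt (2 * (1 - c)) ^ (CARD('n) - 2)"
proof -
  define M where "M = d * (d - 2) / (d - 1) * (unit_ball_vol d / unit_ball_vol (d - 1))"
  define k where "k = CARD('n) - 2"
  have k: "k \<ge> 1" using d by (simp add: k_def)
  note cover = card_spherical_cover[OF _ _ _ _ _ d, folded d_def k_def, folded M_def]
  obtain b :: "real^'n" where "b \<in> Basis" by (meson nonempty_Basis ex_in_conv)
  then have b: "norm b = 1" "b \<bullet> b = 1"
    by (auto simp: inner_Basis)
  then have b': "b \<noteq> - b"
    by (metis inner_minus_left one_neq_neg_one)
  \<comment> \<open>serves \<open>c < 0\<close>, where two antipodal points or a single point already suffice\<close>
  have M2: "M \<le> 2 * sqrt 2 ^ k"
  proof -
    \<comment> \<open>Every vector has a nonnegative inner product with \<open>b\<close> or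
      \<open>- b\<close>, so the pair is a cover for cosine 0.\<close>
    have "M \<le> real (card {b, - b}) * sqrt (2 * (1 - 0)) ^ k"
      using b by (intro cover) auto
    then show ?thesis using b' by simp
  qed
  have "\<exists>S :: (real^'n) set. finite S \<and> (\<forall>w\<in>S. norm w = 1) \<and>
    (\<forall>v\<in>S. \<forall>w\<in>S. v \<noteq> w \<longrightarrow> v \<bullet> w < c) \<and> M \<le> real (card S) * sqrt (2 * (1 - c)) ^ k"
  proof (cases "c \<ge> 0")
    case True
    define code where "code S \<longleftrightarrow> finite S \<and> (\<forall>w\<in>S. norm w = 1) \<and>
      (\<forall>v\<in>S. \<forall>w\<in>S. v \<noteq> w \<longrightarrow> v \<bullet> w < c)" for S :: "(real^'n) set"
    show ?thesis
    proof (rule ccontr)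
      assume "\<not> ?thesis"
      \<comment> \<open>Denying the claim bounds the cardinality of all codes, so a largest one
        exists.\<close>
      then have small: "real (card S) * sqrt (2 * (1 - c)) ^ k < M" if "code S" for S
        using that by (force simp: code_def)
      have "card S < nat \<lceil>M / sqrt (2 * (1 - c)) ^ k\<rceil>" if "code S" for S
      proof -
        have "real (card S) < M / sqrt (2 * (1 - c)) ^ k"
          using small[OF that] c by (simp add: field_simps)
        then show ?thesis by linarith
      qed
      moreover have "code {}" by (simp add: code_def)
      ultimately obtain S where S: "code S" and max: "\<And>S'. code S' \<Longrightarrow> card S' \<le> card S"
        using ex_has_greatest_nat[of code "{}" card] by (metis less_imp_le)
      have "\<exists>w\<in>S. c \<le> x \<bullet> w" if x: "norm x = 1" for x
      proof (rule ccontr)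
        assume far: "\<not> (\<exists>w\<in>S. c \<le> x \<bullet> w)"
        have "x \<notin> S"
          using far c x by (auto simp: dot_square_norm)
        moreover have "code (insert x S)"
          using S far x by (auto simp: code_def inner_commute not_le)
        ultimately show False
          using max[of "insert x S"] S by (simp add: code_def)
      qed
      then have "M \<le> real (card S) * sqrt (2 * (1 - c)) ^ k"
        using S True c by (intro cover) (auto simp: code_def)
      with small[OF S] show False by simp
    qed
  next
    case neg: False
    have b2: "2 * sqrt 2 ^ k \<le> 2 * sqrt (2 * (1 - c)) ^ k"
      using neg by (intro mult_left_mono power_mono) auto
    show ?thesis
    proof (cases "c > -1")
      case True
      then show ?thesis
        using b b' M2 b2 by (intro exI[of _ "{b, - b}"]) auto
    next
      case False
      \<comment> \<open>For \<open>c \<le> -1\<close> the single point \<open>b\<close> is taken,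
        and \<open>sqrt (2 * (1 - c)) \<ge> 2\<close>. The bound \<open>M2\<close> suffices once
        \<open>2 \<le> sqrt 2 ^ k\<close>; for \<open>k = 1\<close> it is too weak, but there
        \<open>M\<close> is exactly 2.\<close>
      have "M \<le> 2 ^ k"
      proof (cases "k = 1")
        case True
        then have "d = 3" using d by (simp add: k_def d_def)
        then show ?thesis using True by (simp add: M_def unit_ball_vol_2 unit_ball_vol_3)
      next
        case False
        with k have "sqrt 2 ^ 2 \<le> sqrt 2 ^ k"
          by (intro power_increasing) auto
        then have "2 * sqrt 2 ^ k \<le> sqrt 2 ^ k * sqrt 2 ^ k"
          by (intro mult_right_mono) auto
        also have "\<dots> = 2 ^ k"
          by (simp flip: power_mult_distrib)
        finally show ?thesis using M2 by simp
      qed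
      also have "2 ^ k \<le> sqrt (2 * (1 - c)) ^ k"
        using False by (intro power_mono real_le_rsqrt) auto
      finally show ?thesis
        using b by (intro exI[of _ "{b}"]) simp
    qed
  qed
  then show ?thesis by (simp only: M_def k_def)
qed

section \<open>The gap after few iterations\<close>

text \<open>Convexification keeps common affine minorants: the conjugate of the minimum at the slope
  \<open>p\<close> is at most \<open>- \<gamma>\<close>, and \<open>p\<close> is one of the slopes
  in the supremum defining the biconjugate.\<close>

lemma conv_min_ge_affine:
  fixes f h :: "'a::real_inner \<Rightarrow> ereal"
  assumes f: "\<And>x. ereal (\<gamma> + p \<bullet> x) \<le> f x" and h: "\<And>x. ereal (\<gamma> + p \<bullet> x) \<le> h x"
  shows "ereal (\<gamma> + p \<bullet> x) \<le> conv_min f h x"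
proof -
  have "conjugate (\<lambda>x. min (f x) (h x)) p \<le> ereal (- \<gamma>)"
    unfolding conjugate_def
  proof (rule SUP_least)
    fix x
    have "ereal (\<gamma> + p \<bullet> x) \<le> min (f x) (h x)" using f h by simp
    then show "ereal (p \<bullet> x) - min (f x) (h x) \<le> ereal (- \<gamma>)"
      by (cases "min (f x) (h x)") auto
  qed
  then have "ereal (\<gamma> + p \<bullet> x) \<le> ereal (x \<bullet> p) - conjugate (\<lambda>x. min (f x) (h x)) p"
    by (cases "conjugate (\<lambda>x. min (f x) (h x)) p") (auto simp: inner_commute)
  also have "\<dots> \<le> conv_min f h x"
    unfolding conv_min_def by (subst (2) conjugate_def) (rule SUP_upper, simp)
  finally show ?thesis .
qed

text \<open>The objective splits into a part in \<open>z\<close> and a part in \<open>x\<close>, so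
  separate lower bounds add up.\<close>

lemma dual_fun_ge:
  fixes P :: "('n::finite) msp"
  assumes R: "R > 0"
    and F: "\<And>z. z \<in> cball 0 R \<Longrightarrow> \<alpha> \<le> F_cost R P (t - 1) z + l \<bullet> (y - z)"
    and g: "\<And>x. \<mu> \<le> g_cost T P t k x + q x"
  shows "\<alpha> + \<mu> \<le> dual_fun T R P t k q y l"
  unfolding dual_fun_def
proof (rule cINF_greatest)
  show "cball 0 R \<times> cball 0 R \<noteq> {}" using R by auto
  fix p :: "(real^'n) \<times> (real^'n)" assume "p \<in> cball 0 R \<times> cball 0 R"
  then obtain x z where "p = (x, z)" "z \<in> cball 0 R" by auto
  then show "\<alpha> + \<mu> \<le> (case p of (x, z) \<Rightarrow> node_cost T R P t k z x + l \<bullet> (y - z) + q x)"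
    using F[of z] g[of x] by (simp add: node_cost_def)
qed

text \<open>The equality case of Cauchy-Schwarz, obtained by expanding the squared distance of the
  two sides.\<close>

lemma eq_scaleR_of_inner_ge:
  fixes l w :: "'a::real_inner"
  assumes "norm w = R" "R > 0" "norm l \<le> a" "a * R \<le> l \<bullet> w"
  shows "l = (a / R) *\<^sub>R w"
proof -
  have "a \<ge> 0" using assms norm_ge_zero[of l] by linarith
  have "(norm (l - (a / R) *\<^sub>R w))\<^sup>2 = (norm l)\<^sup>2 - 2 * (a / R) * (l \<bullet> w) + (a / R)\<^sup>2 * (norm w)\<^sup>2"
    unfolding power2_norm_eq_inner
    by (simp add: inner_diff_left inner_diff_right inner_commute power2_eq_square algebra_simps)
  also have "\<dots> = (norm l)\<^sup>2 - 2 * (a / R) * (l \<bullet> w) + a\<^sup>2"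
    using assms by (simp add: power_divide)
  also have "\<dots> \<le> a\<^sup>2 - 2 * (a / R) * (a * R) + a\<^sup>2"
    using assms \<open>a \<ge> 0\<close> by (intro add_mono diff_mono mult_left_mono power_mono) auto
  also have "\<dots> = 0" using assms by (simp add: power2_eq_square)
  finally show ?thesis by simp
qed

lemma avg_le:
  fixes K :: nat
  assumes "K > 0" "\<And>k. k \<in> {1..K} \<Longrightarrow> f k \<le> g k + (c::real)"
  shows "(\<Sum>k = 1..K. f k) / K \<le> (\<Sum>k = 1..K. g k) / K + c"
proof -
  have "(\<Sum>k = 1..K. f k) \<le> (\<Sum>k = 1..K. g k + c)" by (intro sum_mono assms(2))
  then show ?thesis using assms(1) by (simp add: sum.distrib field_simps)
qed

section \<open>A fixed run of \<open>N\<close> iterations on a hard instance\<close>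

locale dual_dp_run =
  fixes T N :: nat and R L \<epsilon> :: real and P :: "('n::finite) msp" and tr :: "'n trace"
  assumes T2: "T \<ge> 2" and R_pos: "R > 0" and L_pos: "L > 0" and \<epsilon>_pos: "\<epsilon> > 0"
    and nodes_pos: "\<And>t. t \<in> {1..<T} \<Longrightarrow> nodes P t > 0"
    and hard: "hard_form T R L \<epsilon> P"
    and run: "algorithm_run T R \<epsilon> P tr N"
begin

definition \<delta> :: real where "\<delta> = \<epsilon> / (real T - 1)"

\<comment> \<open>the forward solution at node \<open>(t, k)\<close>; at the last stage the state is a dummy\<close>
definition center :: "nat \<Rightarrow> nat \<Rightarrow> real^'n" where
  "center t k = (if t < T then pt P t k else 0)"

definition piece :: "nat \<Rightarrow> nat \<Rightarrow> real^'n \<Rightarrow> real" where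
  "piece t k x = val P t k + lip P (t + 1) / R * (pt P t k \<bullet> (x - pt P t k))"

text \<open>Visits in all \<open>N\<close> iterations are collected, so that the bounds below are
  the same at every iteration \<open>i \<le> N\<close>.\<close>

definition visited :: "nat \<Rightarrow> nat set" where
  "visited t = {k \<in> {1..nodes P t}. \<exists>j\<in>{1..N}. trial tr j t = pt P t k}"

definition lo_val :: "nat \<Rightarrow> nat \<Rightarrow> real" where
  "lo_val t k = (if t < T \<and> k \<in> visited t then val P t k else 0)"

text \<open>\<open>3 / 2 * \<delta>\<close> is chosen so that a loss of \<open>\<delta>\<close>
  leaves \<open>\<delta> / 2\<close>, the lower bound on all \<open>val\<close>.\<close>

definition up_val :: "nat \<Rightarrow> nat \<Rightarrow> real" where
  "up_val t k = (if t < T then if k \<in> visited t then val P t k else 3 / 2 * \<delta> else 0)"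

text \<open>By stagewise independence the stages from \<open>t\<close> on contribute the sum of
  their node averages. The sum is empty for \<open>t = T\<close>.\<close>

definition lo_sum :: "nat \<Rightarrow> real" where
  "lo_sum t = (\<Sum>s = t..<T. (\<Sum>k = 1..nodes P s. lo_val s k) / nodes P s)"

definition up_sum :: "nat \<Rightarrow> real" where
  "up_sum t = (\<Sum>s = t..<T. (\<Sum>k = 1..nodes P s. up_val s k) / nodes P s)"

lemma \<delta>_pos: "\<delta> > 0"
  using T2 \<epsilon>_pos by (simp add: \<delta>_def)

lemma lip_less: "t \<in> {1..<T} \<Longrightarrow> lip P (t + 1) < lip P t"
  using hard by (auto simp: hard_form_def)

lemma lip_pos: "t \<in> {1..T} \<Longrightarrow> lip P t > 0"
proof -
  assume t: "t \<in> {1..T}"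
  then have "lip P T \<le> lip P t"
  proof (induction "T - t" arbitrary: t)
    case (Suc m)
    from Suc.hyps(2) Suc.prems have "lip P T \<le> lip P (t + 1)" by (intro Suc.hyps(1)) auto
    moreover have "lip P (t + 1) < lip P t" using Suc by (intro lip_less) auto
    ultimately show ?case by linarith
  qed auto
  moreover have "L / 2 \<le> lip P T" using hard by (simp add: hard_form_def)
  ultimately show ?thesis using L_pos by linarith
qed

lemma nodes_T: "nodes P T = 1"
  using hard by (simp add: hard_form_def)

lemma nodes_pos': "t \<in> {1..T} \<Longrightarrow> nodes P t > 0"
  using nodes_pos[of t] nodes_T by (cases "t = T") auto

lemma
  assumes "t \<in> {1..<T}" "k \<in> {1..nodes P t}"
  shows norm_pt: "norm (pt P t k) = R"
    and val_gt: "\<delta> / 2 < val P t k" and val_less: "val P t k < \<delta>"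
proof -
  have t: "t \<in> {1..T - 1}" using assms by auto
  have "norm (pt P t k) = R \<and> \<epsilon> / (2 * (real T - 1)) < val P t k \<and> val P t k < \<epsilon> / (real T - 1)"
    using hard t assms(2) unfolding hard_form_def Let_def by blast
  then show "norm (pt P t k) = R" "\<delta> / 2 < val P t k" "val P t k < \<delta>"
    by (simp_all add: \<delta>_def mult.commute)
qed

text \<open>The product of \<open>\<beta>\<close> and \<open>lip P (t + 1)\<close> is
  \<open>\<delta>\<close>, so separation means that the affine function of node \<open>k\<close>
  drops by more than \<open>\<delta>\<close> on the way to any other point of the stage.\<close>

lemma pt_separated:
  assumes t: "t \<in> {1..<T}" and k: "k \<in> {1..nodes P t}" "l \<in> {1..nodes P t}" "l \<noteq> k"
  shows "lip P (t + 1) / R * (pt P t k \<bullet> (pt P t l - pt P t k)) < - \<delta>"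
proof -
  have pos: "lip P (t + 1) > 0" using lip_pos t by auto
  have "(pt P t l - pt P t k) \<bullet> pt P t k < - (\<epsilon> / ((real T - 1) * lip P (t + 1))) * R"
    using hard t k by (auto simp: hard_form_def Let_def)
  also have "- (\<epsilon> / ((real T - 1) * lip P (t + 1))) * R = - \<delta> * (R / lip P (t + 1))"
    by (simp add: \<delta>_def)
  finally have "lip P (t + 1) / R * ((pt P t l - pt P t k) \<bullet> pt P t k)
      < lip P (t + 1) / R * (- \<delta> * (R / lip P (t + 1)))"
    using pos R_pos by (intro mult_strict_left_mono) auto
  also have "\<dots> = - \<delta>" using pos R_pos by simp
  finally show ?thesis by (simp add: inner_commute)
qed

lemma piece_neg:
  assumes "t \<in> {1..<T}" "k \<in> {1..nodes P t}" "l \<in> {1..nodes P t}" "l \<noteq> k"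
  shows "piece t k (pt P t l) < 0"
  using pt_separated[OF assms] val_less[OF assms(1,2)] by (simp add: piece_def)

lemma piece_lipschitz:
  assumes "t \<in> {1..<T}" "k \<in> {1..nodes P t}"
  shows "lip P (t + 1) / R * (pt P t k \<bullet> v) \<le> lip P (t + 1) * norm v"
proof -
  have pos: "lip P (t + 1) > 0" using lip_pos assms by auto
  have "pt P t k \<bullet> v \<le> R * norm v"
    using norm_cauchy_schwarz[of "pt P t k" v] norm_pt[OF assms] by simp
  then have "lip P (t + 1) / R * (pt P t k \<bullet> v) \<le> lip P (t + 1) / R * (R * norm v)"
    using pos R_pos by (intro mult_left_mono) auto
  then show ?thesis using R_pos by simp
qed

lemma F_cost_eq:
  assumes "t \<in> {1..<T}"
  shows "F_cost R P t x = Max (insert 0 ((\<lambda>k. piece t k x) ` {1..nodes P t}))"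
  using assms by (simp add: F_cost_def piece_def)

lemma F_cost_nonneg: "F_cost R P t x \<ge> 0"
  by (auto simp: F_cost_def intro: Max_ge)

lemma F_cost_ge_piece:
  assumes "t \<in> {1..<T}" "k \<in> {1..nodes P t}"
  shows "piece t k x \<le> F_cost R P t x"
  unfolding F_cost_eq[OF assms(1)] using assms(2) by (intro Max_ge) auto

lemma center_cball:
  assumes "t \<in> {1..T}" "k \<in> {1..nodes P t}"
  shows "center t k \<in> cball 0 R"
  using assms norm_pt[of t k] R_pos by (auto simp: center_def)

section \<open>Recurrences and Lipschitz bounds for the lower approximations\<close>

lemma
  assumes "i \<in> {1..N}"
  shows forward: "forward_step T R P tr i" and backward: "backward_step T R P tr i"
    and root: "root_step R tr i"
  using run assms by (auto simp: algorithm_run_def)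

lemma
  shows Qlo_0: "t < T \<Longrightarrow> Qlo tr 0 t x = 0" and Qup_0: "t < T \<Longrightarrow> Qup tr 0 t x = \<infinity>"
    and Qlo_T: "Qlo tr i T x = 0" and Qup_T: "Qup tr i T x = 0"
    and LB_0: "LB tr 0 = 0" and UB_0: "UB tr 0 = \<infinity>"
  using run by (auto simp: algorithm_run_def initialized_def)

lemma
  assumes "i \<in> {1..N}" "t \<in> {1..T}" "k \<in> {1..nodes P t}"
  shows norm_dual: "norm (dual tr i t k) \<le> lip P t"
    and dual_optimal: "norm l \<le> lip P t \<Longrightarrow>
      dual_fun T R P t k (Qlo tr i t) (trial tr i (t - 1)) l \<le> vlo tr i t k"
    and vlo_eq: "vlo tr i t k = dual_fun T R P t k (Qlo tr i t) (trial tr i (t - 1)) (dual tr i t k)"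
    and vup_eq: "vup tr i t k = ereal (node_cost T R P t k (fz tr i t k) (fx tr i t k)
        + lip P t * norm (trial tr i (t - 1) - fz tr i t k)) + Qup tr i t (fx tr i t k)"
proof -
  note step = bspec[OF bspec[OF backward[OF assms(1), unfolded backward_step_def] assms(2), THEN conjunct1] assms(3)]
  note max = step[THEN conjunct1] and vlo = step[THEN conjunct2, THEN conjunct1]
    and vup = step[THEN conjunct2, THEN conjunct2]
  show "norm (dual tr i t k) \<le> lip P t" using max by (simp add: is_arg_max_def)
  show "dual_fun T R P t k (Qlo tr i t) (trial tr i (t - 1)) l \<le> vlo tr i t k" if "norm l \<le> lip P t"
    using max that unfolding vlo by (simp add: is_arg_max_linorder)
  show "vlo tr i t k = dual_fun T R P t k (Qlo tr i t) (trial tr i (t - 1)) (dual tr i t k)"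
    by (fact vlo)
  show "vup tr i t k = ereal (node_cost T R P t k (fz tr i t k) (fx tr i t k)
        + lip P t * norm (trial tr i (t - 1) - fz tr i t k)) + Qup tr i t (fx tr i t k)"
    by (fact vup)
qed

definition lower_cut :: "nat \<Rightarrow> nat \<Rightarrow> real^'n \<Rightarrow> real" where
  "lower_cut i t x = (\<Sum>k = 1..nodes P (t + 1). vlo tr i (t + 1) k - dual tr i (t + 1) k \<bullet> (trial tr i t - x))
    / real (nodes P (t + 1))"

definition upper_cone :: "nat \<Rightarrow> nat \<Rightarrow> real^'n \<Rightarrow> ereal" where
  "upper_cone i t x = (\<Sum>k = 1..nodes P (t + 1). vup tr i (t + 1) k + ereal (lip P (t + 1) * norm (x - trial tr i t)))
    / ereal (real (nodes P (t + 1)))"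

lemma
  assumes "Suc i \<le> N" "t < T"
  shows Qlo_Suc: "Qlo tr (Suc i) t x = max (Qlo tr i t x) (lower_cut (Suc i) t x)"
    and Qup_Suc: "Qup tr (Suc i) t = conv_min (Qup tr i t) (upper_cone (Suc i) t)"
proof -
  have i: "Suc i \<in> {1..N}" and t: "t + 1 \<in> {1..T}" using assms by auto
  note step = bspec[OF backward[OF i, unfolded backward_step_def] t, THEN conjunct2]
  show "Qlo tr (Suc i) t x = max (Qlo tr i t x) (lower_cut (Suc i) t x)"
    using step[THEN conjunct1, THEN fun_cong, of x] by (simp only: diff_Suc_1 add_diff_cancel_right' lower_cut_def)
  have "upper_cone (Suc i) t = (\<lambda>x. (\<Sum>k = 1..nodes P (t + 1). vup tr (Suc i) (t + 1) k
      + ereal (lip P (t + 1) * norm (x - trial tr (Suc i) t))) / ereal (real (nodes P (t + 1))))"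
    by (rule ext) (rule upper_cone_def)
  then show "Qup tr (Suc i) t = conv_min (Qup tr i t) (upper_cone (Suc i) t)"
    using step[THEN conjunct2] by (simp only: diff_Suc_1 add_diff_cancel_right')
qed

lemma Qlo_nonneg: "i \<le> N \<Longrightarrow> t \<le> T \<Longrightarrow> Qlo tr i t x \<ge> 0"
proof (induction i)
  case 0
  then show ?case using Qlo_0[of t x] Qlo_T[of 0 x] by (cases "t = T") auto
next
  case (Suc i)
  then show ?case using Qlo_Suc[of i t x] Qlo_T[of "Suc i" x] by (cases "t = T") auto
qed

text \<open>The bound on the multipliers limits the slope of every averaged term.\<close>

lemma lower_cut_lipschitz:
  assumes i: "i \<in> {1..N}" and t: "t < T"
  shows "lower_cut i t x \<le> lower_cut i t y + lip P (t + 1) * norm (x - y)"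
proof -
  have K: "nodes P (t + 1) > 0" using nodes_pos'[of "t + 1"] t by simp
  have "(\<Sum>k = 1..nodes P (t + 1). vlo tr i (t + 1) k - dual tr i (t + 1) k \<bullet> (trial tr i t - x))
    \<le> (\<Sum>k = 1..nodes P (t + 1). vlo tr i (t + 1) k - dual tr i (t + 1) k \<bullet> (trial tr i t - y)
          + lip P (t + 1) * norm (x - y))"
  proof (rule sum_mono)
    fix k assume k: "k \<in> {1..nodes P (t + 1)}"
    have "dual tr i (t + 1) k \<bullet> (x - y) \<le> norm (dual tr i (t + 1) k) * norm (x - y)"
      by (rule norm_cauchy_schwarz)
    also have "\<dots> \<le> lip P (t + 1) * norm (x - y)"
      using norm_dual[OF i _ k] t by (intro mult_right_mono) auto
    finally show "vlo tr i (t + 1) k - dual tr i (t + 1) k \<bullet> (trial tr i t - x)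
      \<le> vlo tr i (t + 1) k - dual tr i (t + 1) k \<bullet> (trial tr i t - y) + lip P (t + 1) * norm (x - y)"
      by (simp add: inner_diff_right)
  qed
  then have "lower_cut i t x \<le> (\<Sum>k = 1..nodes P (t + 1).
      vlo tr i (t + 1) k - dual tr i (t + 1) k \<bullet> (trial tr i t - y) + lip P (t + 1) * norm (x - y))
      / real (nodes P (t + 1))"
    unfolding lower_cut_def by (intro divide_right_mono) auto
  also have "\<dots> = lower_cut i t y + lip P (t + 1) * norm (x - y)"
    using K by (simp only: lower_cut_def sum.distrib add_divide_distrib) simp
  finally show ?thesis .
qed

text \<open>Maxima preserve the Lipschitz constant. What matters is that this constant is strictly
  below the factor \<open>lip P t\<close> in \<open>g_cost\<close> at stages
  \<open>t \<ge> 1\<close>.\<close>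

lemma Qlo_lipschitz:
  assumes "i \<le> N" "t < T"
  shows "Qlo tr i t x \<le> Qlo tr i t y + lip P (t + 1) * norm (x - y)"
  using assms
proof (induction i)
  case 0
  then show ?case using Qlo_0[of t] lip_pos[of "t + 1"] by (simp add: less_imp_le)
next
  case (Suc i)
  then have "Qlo tr i t x \<le> Qlo tr i t y + lip P (t + 1) * norm (x - y)" by simp
  moreover have "lower_cut (Suc i) t x \<le> lower_cut (Suc i) t y + lip P (t + 1) * norm (x - y)"
    using Suc by (intro lower_cut_lipschitz) auto
  ultimately show ?case
    using Suc.prems unfolding Qlo_Suc[OF Suc.prems] by linarith
qed

text \<open>Leaving the center costs \<open>lip P t\<close> per unit of distance in
  \<open>g_cost\<close>, while \<open>Qlo\<close> falls at a rate of at most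
  \<open>lip P (t + 1)\<close>.\<close>

lemma g_Qlo_ge:
  assumes "i \<le> N" "t \<in> {1..T}"
  shows "Qlo tr i t (center t k) \<le> g_cost T P t k x + Qlo tr i t x"
proof (cases "t < T")
  case True
  have "Qlo tr i t (center t k) \<le> Qlo tr i t x + lip P (t + 1) * norm (pt P t k - x)"
    using Qlo_lipschitz[OF assms(1) True] True by (simp add: center_def)
  also have "lip P (t + 1) * norm (pt P t k - x) \<le> lip P t * norm (pt P t k - x)"
    using lip_less[of t] True assms by (intro mult_right_mono) auto
  finally show ?thesis using True by (simp add: g_cost_def norm_minus_commute)
qed (use assms in \<open>auto simp: g_cost_def Qlo_T\<close>)

lemma g_center: "g_cost T P t k (center t k) = 0"
  by (simp add: g_cost_def center_def)

text \<open>The infimum is evaluated at the pair of \<open>center t k\<close> and \<open>z\<close>.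
  Most of the proof is the boundedness from below that a real infimum requires.\<close>

lemma dual_fun_le:
  assumes i: "i \<le> N" and t: "t \<in> {1..T}" and k: "k \<in> {1..nodes P t}" and z: "z \<in> cball 0 R"
  shows "dual_fun T R P t k (Qlo tr i t) y l
    \<le> F_cost R P (t - 1) z + l \<bullet> (y - z) + Qlo tr i t (center t k)"
proof -
  have "dual_fun T R P t k (Qlo tr i t) y l
    \<le> (case (center t k, z) of (x, z) \<Rightarrow> node_cost T R P t k z x + l \<bullet> (y - z) + Qlo tr i t x)"
    unfolding dual_fun_def
  proof (rule cINF_lower)
    show "bdd_below ((\<lambda>(x, z). node_cost T R P t k z x + l \<bullet> (y - z) + Qlo tr i t x) ` (cball 0 R \<times> cball 0 R))"
    proof (rule bdd_belowI2)
      fix p :: "(real^'n) \<times> (real^'n)" assume "p \<in> cball 0 R \<times> cball 0 R"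
      then obtain x z where p: "p = (x, z)" "norm z \<le> R" by auto
      have "g_cost T P t k x \<ge> 0"
        using lip_pos[OF t] by (simp add: g_cost_def)
      moreover have "- (norm l * (norm y + R)) \<le> l \<bullet> (y - z)"
      proof -
        have "\<bar>l \<bullet> (y - z)\<bar> \<le> norm l * norm (y - z)" by (rule Cauchy_Schwarz_ineq2)
        also have "\<dots> \<le> norm l * (norm y + R)"
          using p norm_triangle_ineq4[of y z] by (intro mult_left_mono) auto
        finally show ?thesis by linarith
      qed
      ultimately show "- (norm l * (norm y + R))
          \<le> (case p of (x, z) \<Rightarrow> node_cost T R P t k z x + l \<bullet> (y - z) + Qlo tr i t x)"
        using F_cost_nonneg[of "t - 1" z] Qlo_nonneg[OF i, of t x] t by (simp add: p node_cost_def)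
    qed
    show "(center t k, z) \<in> cball 0 R \<times> cball 0 R"
      using center_cball[OF t k] z by simp
  qed
  then show ?thesis by (simp add: node_cost_def g_center)
qed

section \<open>Forward solutions and visited points\<close>

text \<open>Comparing the optimal pair with the one having \<open>center t k\<close> as its state
  and the same \<open>z\<close> leaves \<open>(lip P t - lip P (t + 1)) * norm (fx tr i t k - center
  t k) \<le> 0\<close>. At stage \<open>T\<close> there is no such penalty on the state, hence the
  restriction \<open>t < T\<close>.\<close>

lemma
  assumes i: "i \<in> {1..N}" and t: "t \<in> {1..T}" and k: "k \<in> {1..nodes P t}"
  shows fx_eq: "t < T \<Longrightarrow> fx tr i t k = center t k" and fz_cball: "fz tr i t k \<in> cball 0 R"
proof -
  have *: "is_arg_min
          (\<lambda>(x, z). node_cost T R P t k z x + lip P t * norm (trial tr i (t - 1) - z)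
                      + Qlo tr (i - 1) t x)
          (\<lambda>(x, z). x \<in> cball 0 R \<and> z \<in> cball 0 R)
          (fx tr i t k, fz tr i t k)"
    by (rule bspec[OF bspec[OF forward[OF i, unfolded forward_step_def, THEN conjunct1] t] k])
  then show z: "fz tr i t k \<in> cball 0 R" by (simp add: is_arg_min_def)
  assume tT: "t < T"
  have "node_cost T R P t k (fz tr i t k) (fx tr i t k) + Qlo tr (i - 1) t (fx tr i t k)
      \<le> node_cost T R P t k (fz tr i t k) (center t k) + Qlo tr (i - 1) t (center t k)"
  proof -
    let ?f = "\<lambda>(x, z). node_cost T R P t k z x + lip P t * norm (trial tr i (t - 1) - z) + Qlo tr (i - 1) t x"
    have "?f (fx tr i t k, fz tr i t k) \<le> ?f (center t k, fz tr i t k)"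
      using * z center_cball[OF t k] unfolding is_arg_min_linorder by blast
    then show ?thesis by simp
  qed
  then have "lip P t * norm (fx tr i t k - center t k) + Qlo tr (i - 1) t (fx tr i t k)
      \<le> Qlo tr (i - 1) t (center t k)"
    using tT by (simp add: node_cost_def g_cost_def center_def)
  also have "\<dots> \<le> Qlo tr (i - 1) t (fx tr i t k) + lip P (t + 1) * norm (center t k - fx tr i t k)"
    using i tT by (intro Qlo_lipschitz) auto
  finally have "(lip P t - lip P (t + 1)) * norm (fx tr i t k - center t k) \<le> 0"
    by (simp add: norm_minus_commute algebra_simps)
  then show "fx tr i t k = center t k"
    using lip_less[of t] tT t by (auto simp: mult_le_0_iff)
qed

lemma trial_eq:
  assumes "i \<in> {1..N}" "t \<in> {1..<T}"
  obtains l where "l \<in> {1..nodes P t}" "l \<in> visited t" "trial tr i t = pt P t l"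
proof -
  have "t \<in> {1..T - 1}" using assms by auto
  then obtain l where l: "l \<in> {1..nodes P t}" "trial tr i t = fx tr i t l"
    using bspec[OF forward[OF assms(1), unfolded forward_step_def, THEN conjunct2]]
    unfolding is_arg_max_def by blast
  then have "trial tr i t = pt P t l"
    using fx_eq[OF assms(1) _ l(1)] assms(2) by (simp add: center_def)
  then show ?thesis
    using l assms by (intro that[of l]) (auto simp: visited_def)
qed

lemma pt_inj:
  assumes "t \<in> {1..<T}" "k \<in> {1..nodes P t}" "l \<in> {1..nodes P t}" "pt P t k = pt P t l"
  shows "k = l"
proof (rule ccontr)
  assume "k \<noteq> l"
  then have "lip P (t + 1) / R * (pt P t k \<bullet> (pt P t l - pt P t k)) < - \<delta>"
    using assms by (intro pt_separated) auto
  then show False using \<delta>_pos unfolding assms(4) by simp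
qed

text \<open>An iteration has one trial state per stage, and distinct nodes have distinct
  points.\<close>

lemma card_visited:
  assumes t: "t \<in> {1..<T}"
  shows "card (visited t) \<le> N"
proof -
  have "card (visited t) = card (pt P t ` visited t)"
    by (rule card_image[symmetric]) (auto intro!: inj_onI pt_inj[OF t] simp: visited_def)
  also have "\<dots> \<le> card ((\<lambda>j. trial tr j t) ` {1..N})"
  proof (intro card_mono subsetI)
    fix v assume "v \<in> pt P t ` visited t"
    then obtain j where "j \<in> {1..N}" "v = trial tr j t" by (force simp: visited_def)
    then show "v \<in> (\<lambda>j. trial tr j t) ` {1..N}" by blast
  qed simp
  also have "\<dots> \<le> N"
    using card_image_le[of "{1..N}"] by simp
  finally show ?thesis .
qed

section \<open>Values of the lower approximations\<close>

text \<open>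
  Near \<open>w\<^sub>t\<^sub>l\<close> only the \<open>l\<close>-th piece of \<open>F\<^sub>t\<close> is active. As \<open>w\<^sub>t\<^sub>l\<close> lies on the boundary of the ball, its
  subgradients are the \<open>(L\<^sub>t\<^sub>+\<^sub>1 / R + s) w\<^sub>t\<^sub>l\<close> with \<open>s \<ge> 0\<close>, and the dual bound leaves \<open>s = 0\<close>.
\<close>
lemma cut_slope_unique:
  assumes t: "t \<in> {1..<T}" and l: "l \<in> {1..nodes P t}" and u: "norm u \<le> lip P (t + 1)"
    and supp: "\<And>z. z \<in> cball 0 R \<Longrightarrow> val P t l \<le> F_cost R P t z + u \<bullet> (pt P t l - z)"
  shows "u = (lip P (t + 1) / R) *\<^sub>R pt P t l"
proof -
  let ?w = "pt P t l"
  \<comment> \<open>Moving from \<open>pt P t l\<close> towards the origin stays in the ball, and by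
    continuity piece \<open>l\<close> remains the only active one for small
    \<open>s\<close>.\<close>
  define z where "z s = (1 - s) *\<^sub>R ?w" for s :: real
  have lim: "((\<lambda>s. piece t k (z s)) \<longlongrightarrow> piece t k (z 0)) (at_right 0)" for k
    unfolding piece_def z_def by (intro tendsto_intros)
  have "eventually (\<lambda>s. s > 0 \<and> s < 1 \<and> 0 < piece t l (z s) \<and>
      (\<forall>k\<in>{1..nodes P t} - {l}. piece t k (z s) < 0)) (at_right 0)"
  proof (intro eventually_conj eventually_ball_finite ballI)
    show "eventually (\<lambda>s::real. s > 0) (at_right 0)" by (rule eventually_at_right_less)
    show "eventually (\<lambda>s::real. s < 1) (at_right 0)"
      by (rule order_tendstoD[of "\<lambda>s. s" 0]) (auto intro: tendsto_eq_intros)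
    have "piece t l (z 0) > 0"
      using val_gt[OF t l] \<delta>_pos by (simp add: piece_def z_def)
    then show "eventually (\<lambda>s. 0 < piece t l (z s)) (at_right 0)"
      using lim order_tendstoD(1) by blast
    fix k assume "k \<in> {1..nodes P t} - {l}"
    then have "piece t k (z 0) < 0"
      using piece_neg[OF t, of k l] l by (simp add: z_def)
    then show "eventually (\<lambda>s. piece t k (z s) < 0) (at_right 0)"
      using lim order_tendstoD(2) by blast
  qed simp
  then obtain s where s: "s > 0" "s < 1" "0 < piece t l (z s)"
    "\<And>k. k \<in> {1..nodes P t} - {l} \<Longrightarrow> piece t k (z s) < 0"
    using eventually_happens'[OF trivial_limit_at_right_real] by blast
  have w: "?w \<bullet> ?w = R * R" using norm_pt[OF t l] by (simp add: dot_square_norm power2_eq_square)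
  have "F_cost R P t (z s) = piece t l (z s)"
    unfolding F_cost_eq[OF t] using s l by (intro Max_eqI) (auto, fastforce)
  also have "\<dots> = val P t l - s * (lip P (t + 1) * R)"
    using R_pos by (simp add: piece_def z_def inner_diff_right w algebra_simps)
  finally have "val P t l \<le> val P t l - s * (lip P (t + 1) * R) + u \<bullet> (?w - z s)"
    using supp[of "z s"] s norm_pt[OF t l] R_pos by (simp add: z_def mult_left_le_one_le)
  \<comment> \<open>Cancelling \<open>s\<close> leaves the reverse of Cauchy-Schwarz, which the norm
    bound on \<open>u\<close> turns into equality.\<close>
  then have "s * (lip P (t + 1) * R) \<le> s * (u \<bullet> ?w)"
    by (simp add: z_def inner_diff_right algebra_simps)
  then show ?thesis
    using s eq_scaleR_of_inner_ge[OF norm_pt[OF t l] R_pos u] by simp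
qed

text \<open>The slope of piece \<open>l\<close> is a feasible multiplier, so \<open>vlo\<close> is
  at least \<open>val P t l\<close> plus the later value. Any optimal multiplier then supports
  \<open>F_cost\<close> at \<open>pt P t l\<close> and equals this slope by
  \<open>cut_slope_unique\<close>; evaluation at \<open>pt P t l\<close> bounds \<open>vlo\<close>
  from above.\<close>

lemma visited_cut:
  assumes i: "i \<in> {1..N}" and t: "t \<in> {1..<T}" and l: "l \<in> {1..nodes P t}" "trial tr i t = pt P t l"
    and k: "k \<in> {1..nodes P (t + 1)}"
  shows "vlo tr i (t + 1) k - dual tr i (t + 1) k \<bullet> (trial tr i t - x)
    \<le> piece t l x + Qlo tr i (t + 1) (center (t + 1) k)"
proof -
  let ?w = "pt P t l" and ?q = "Qlo tr i (t + 1) (center (t + 1) k)"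
  let ?l = "(lip P (t + 1) / R) *\<^sub>R ?w"
  have t1: "t + 1 \<in> {1..T}" and iN: "i \<le> N" using t i by auto
  have lip0: "lip P (t + 1) > 0" using lip_pos[OF t1] .
  have w: "norm ?w = R" using norm_pt[OF t l(1)] .
  have "val P t l + ?q \<le> dual_fun T R P (t + 1) k (Qlo tr i (t + 1)) ?w ?l"
  proof (rule dual_fun_ge[OF R_pos])
    fix z :: "real^'n"
    show "val P t l \<le> F_cost R P (t + 1 - 1) z + ?l \<bullet> (?w - z)"
      using F_cost_ge_piece[OF t l(1), of z] by (simp add: piece_def inner_diff_right algebra_simps)
  qed (rule g_Qlo_ge[OF iN t1])
  also have "\<dots> \<le> vlo tr i (t + 1) k"
    using dual_optimal[OF i t1 k, of ?l] w l lip0 R_pos by simp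
  finally have ge: "val P t l + ?q \<le> vlo tr i (t + 1) k" .
  have le: "vlo tr i (t + 1) k \<le> F_cost R P t z + dual tr i (t + 1) k \<bullet> (?w - z) + ?q"
    if "z \<in> cball 0 R" for z
    using dual_fun_le[OF iN t1 k that] vlo_eq[OF i t1 k] l by simp
  have "dual tr i (t + 1) k = ?l"
  proof (rule cut_slope_unique[OF t l(1) norm_dual[OF i t1 k]])
    fix z :: "real^'n" assume "z \<in> cball 0 R"
    then show "val P t l \<le> F_cost R P t z + dual tr i (t + 1) k \<bullet> (?w - z)"
      using ge le[of z] by linarith
  qed
  moreover have "vlo tr i (t + 1) k \<le> val P t l + ?q"
  proof -
    have "F_cost R P t ?w \<le> val P t l"
      unfolding F_cost_eq[OF t]
    proof (rule Max.boundedI)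
      fix a assume "a \<in> insert 0 ((\<lambda>k. piece t k ?w) ` {1..nodes P t})"
      moreover have "0 < val P t l" using val_gt[OF t l(1)] \<delta>_pos by linarith
      moreover have "piece t k ?w \<le> val P t l" if "k \<in> {1..nodes P t}" for k
        using piece_neg[OF t that l(1)] \<open>0 < val P t l\<close> by (cases "k = l") (auto simp: piece_def)
      ultimately show "a \<le> val P t l" by auto
    qed auto
    then show ?thesis using le[of ?w] w by simp
  qed
  ultimately show ?thesis using l by (simp add: piece_def inner_diff_right algebra_simps)
qed

lemma lo_val_nonneg: "t \<in> {1..T} \<Longrightarrow> k \<in> {1..nodes P t} \<Longrightarrow> lo_val t k \<ge> 0"
  using val_gt[of t k] \<delta>_pos by (auto simp: lo_val_def)

lemma lo_sum_nonneg: "t \<ge> 1 \<Longrightarrow> lo_sum t \<ge> 0"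
  unfolding lo_sum_def by (intro sum_nonneg divide_nonneg_nonneg lo_val_nonneg) auto

text \<open>Backward induction over the stages, and over the iterations within a stage. A cut made
  at \<open>pt P t l\<close> adds at most \<open>val P t l\<close> at that point and a negative
  amount at the others. The statement is about averages because a cut averages over the nodes of the
  next stage.\<close>

lemma Qlo_center_avg:
  assumes "t \<in> {1..T}" "i \<le> N"
  shows "(\<Sum>k = 1..nodes P t. Qlo tr i t (center t k)) / nodes P t \<le> lo_sum t"
  using assms
proof (induction "T - t" arbitrary: t i)
  case 0
  then show ?case by (simp add: Qlo_T lo_sum_def)
next
  case (Suc m)
  then have t: "t \<in> {1..<T}" "t + 1 \<in> {1..T}" by auto
  \<comment> \<open>Needed for all \<open>j\<close>, as a cut uses the next stage as already updated
    in the same iteration.\<close>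
  have IH: "(\<Sum>k = 1..nodes P (t + 1). Qlo tr j (t + 1) (center (t + 1) k)) / nodes P (t + 1)
      \<le> lo_sum (t + 1)" if "j \<le> N" for j
    using Suc that by (intro Suc.hyps(1)) auto
  have "Qlo tr i t (center t k) \<le> lo_val t k + lo_sum (t + 1)" if k: "k \<in> {1..nodes P t}" for k
    using Suc.prems(2)
  proof (induction i)
    case 0
    then show ?case using t k lo_sum_nonneg lo_val_nonneg by (simp add: Qlo_0)
  next
    case (Suc j)
    then have j: "Suc j \<in> {1..N}" by simp
    obtain l where l: "l \<in> {1..nodes P t}" "l \<in> visited t" "trial tr (Suc j) t = pt P t l"
      using trial_eq[OF j t(1)] .
    have "lower_cut (Suc j) t (center t k)
        \<le> (\<Sum>k' = 1..nodes P (t + 1). Qlo tr (Suc j) (t + 1) (center (t + 1) k')) / nodes P (t + 1)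
          + piece t l (center t k)"
      unfolding lower_cut_def using visited_cut[OF j t(1) l(1,3)] nodes_pos'[OF t(2)]
      by (intro avg_le) (auto simp: add.commute)
    also have "\<dots> \<le> lo_sum (t + 1) + piece t l (center t k)"
      using IH[of "Suc j"] Suc by simp
    also have "piece t l (center t k) \<le> lo_val t k"
    proof (cases "k = l")
      case True
      then show ?thesis using l t by (simp add: lo_val_def center_def piece_def)
    next
      case False
      then have "piece t l (center t k) < 0"
        using piece_neg[OF t(1) l(1) k] t by (simp add: center_def)
      then show ?thesis using lo_val_nonneg[of t k] t k by auto
    qed
    finally show ?case using Suc t by (simp add: Qlo_Suc)
  qed
  then have "(\<Sum>k = 1..nodes P t. Qlo tr i t (center t k)) / nodes P t
      \<le> (\<Sum>k = 1..nodes P t. lo_val t k) / nodes P t + lo_sum (t + 1)"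
    using nodes_pos'[of t] t by (intro avg_le) auto
  also have "\<dots> = lo_sum t"
    using t by (simp add: lo_sum_def sum.atLeast_Suc_lessThan)
  finally show ?case .
qed

text \<open>With \<open>z = x\<close> in the dual function its linear term cancels that of the cut,
  and \<open>F_cost\<close> is 0 at index 0. No knowledge of the multiplier is required.\<close>

lemma Qlo_root:
  assumes x: "x \<in> cball 0 R" and "i \<le> N"
  shows "Qlo tr i 0 x \<le> lo_sum 1"
  using assms(2)
proof (induction i)
  case 0
  then show ?case using T2 lo_sum_nonneg[of 1] by (simp add: Qlo_0)
next
  case (Suc i)
  then have i: "Suc i \<in> {1..N}" by simp
  have t1: "1 \<in> {1..T}" using T2 by simp
  have "vlo tr (Suc i) 1 k - dual tr (Suc i) 1 k \<bullet> (trial tr (Suc i) 0 - x)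
      \<le> Qlo tr (Suc i) 1 (center 1 k) + 0" if k: "k \<in> {1..nodes P 1}" for k
    using dual_fun_le[OF Suc.prems t1 k x, of "trial tr (Suc i) 0" "dual tr (Suc i) 1 k"] vlo_eq[OF i t1 k]
    by (simp add: F_cost_def)
  then have "lower_cut (Suc i) 0 x \<le> (\<Sum>k = 1..nodes P 1. Qlo tr (Suc i) 1 (center 1 k)) / nodes P 1 + 0"
    unfolding lower_cut_def add_0 using nodes_pos'[OF t1] by (intro avg_le)
  also have "\<dots> \<le> lo_sum 1"
    using Qlo_center_avg[OF t1 Suc.prems] by simp
  finally show ?case using Suc T2 by (simp add: Qlo_Suc)
qed

lemma LB_le: "LB tr N \<le> lo_sum 1"
proof (cases "N = 0")
  case True
  then show ?thesis using LB_0 lo_sum_nonneg[of 1] by simp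
next
  case False
  then have "root_step R tr N" by (intro root) simp
  then show ?thesis using Qlo_root[of "trial tr (N + 1) 0" N]
    by (simp add: root_step_def is_arg_min_def)
qed

section \<open>Values of the upper approximations\<close>

text \<open>In \<open>vup\<close>, \<open>\<alpha>\<close> bounds the cost and penalty of
  \<open>z\<close>, \<open>g_cost\<close> is nonnegative, and \<open>Qup\<close> bounds the rest.
  Averaging over the nodes turns \<open>up_val (t + 1)\<close> into the first term of
  \<open>up_sum (t + 1)\<close>.\<close>

lemma upper_cone_ge:
  assumes i: "i \<in> {1..N}" and t: "t < T"
    and \<alpha>: "\<And>z. z \<in> cball 0 R \<Longrightarrow> \<alpha> \<le> F_cost R P t z + lip P (t + 1) * norm (trial tr i t - z)"
    and Qup: "\<And>k. k \<in> {1..nodes P (t + 1)} \<Longrightarrow>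
      ereal (up_val (t + 1) k + up_sum (t + 2)) \<le> Qup tr i (t + 1) (center (t + 1) k)"
  shows "ereal (\<alpha> + up_sum (t + 1) + lip P (t + 1) * norm (x - trial tr i t)) \<le> upper_cone i t x"
proof -
  let ?K = "nodes P (t + 1)" and ?r = "lip P (t + 1) * norm (x - trial tr i t)"
  have t1: "t + 1 \<in> {1..T}" using t by simp
  have K: "?K > 0" using nodes_pos'[OF t1] .
  have "ereal (\<alpha> + up_val (t + 1) k + up_sum (t + 2)) \<le> vup tr i (t + 1) k" if k: "k \<in> {1..?K}" for k
  proof -
    have "ereal (up_val (t + 1) k + up_sum (t + 2)) \<le> Qup tr i (t + 1) (fx tr i (t + 1) k)"
    proof (cases "t + 1 < T")
      case True
      then show ?thesis using Qup[OF k] fx_eq[OF i t1 k] by simp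
    next
      \<comment> \<open>At stage \<open>T\<close> the forward state is arbitrary, but
        \<open>Qup\<close>, \<open>up_val\<close> and the empty \<open>up_sum\<close> are all
        0.\<close>
      case False
      with t have "t + 1 = T" by simp
      then show ?thesis by (simp add: Qup_T up_val_def up_sum_def)
    qed
    moreover have "0 \<le> g_cost T P (t + 1) k (fx tr i (t + 1) k)"
      using lip_pos[OF t1] by (simp add: g_cost_def)
    then have "ereal \<alpha> \<le> ereal (node_cost T R P (t + 1) k (fz tr i (t + 1) k) (fx tr i (t + 1) k)
        + lip P (t + 1) * norm (trial tr i t - fz tr i (t + 1) k))"
      using \<alpha>[OF fz_cball[OF i t1 k]] by (simp add: node_cost_def)
    ultimately have "ereal \<alpha> + ereal (up_val (t + 1) k + up_sum (t + 2)) \<le> vup tr i (t + 1) k"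
      unfolding vup_eq[OF i t1 k] add_diff_cancel_right' by (rule add_mono[rotated])
    then show ?thesis by (simp add: add.assoc)
  qed
  then have "(\<Sum>k = 1..?K. ereal (\<alpha> + up_val (t + 1) k + up_sum (t + 2)) + ereal ?r) / ereal ?K \<le> upper_cone i t x"
    unfolding upper_cone_def using K by (intro ereal_divide_right_mono sum_mono add_mono) auto
  also have "(\<Sum>k = 1..?K. ereal (\<alpha> + up_val (t + 1) k + up_sum (t + 2)) + ereal ?r) / ereal ?K
      = ereal ((\<Sum>k = 1..?K. up_val (t + 1) k) / ?K + \<alpha> + up_sum (t + 2) + ?r)"
    using K by (simp add: sum.distrib add_divide_distrib)
  also have "(\<Sum>k = 1..?K. up_val (t + 1) k) / ?K + up_sum (t + 2) = up_sum (t + 1)"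
  proof (cases "t + 1 < T")
    case True
    then show ?thesis by (simp add: up_sum_def sum.atLeast_Suc_lessThan)
  next
    case False
    with t have "t + 1 = T" by simp
    then show ?thesis by (simp add: up_val_def up_sum_def)
  qed
  then have "(\<Sum>k = 1..?K. up_val (t + 1) k) / ?K + \<alpha> + up_sum (t + 2) + ?r = \<alpha> + up_sum (t + 1) + ?r"
    by linarith
  finally show ?thesis .
qed

lemma Qup_ge_affine:
  assumes t: "t < T" and i: "i \<le> N"
    and upper_cone: "\<And>j x. j \<in> {1..N} \<Longrightarrow> ereal (\<gamma> + p \<bullet> x) \<le> upper_cone j t x"
  shows "ereal (\<gamma> + p \<bullet> x) \<le> Qup tr i t x"
  using i
proof (induction i arbitrary: x)
  case 0
  then show ?case using t by (simp add: Qup_0)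
next
  case (Suc i)
  show ?case
    unfolding Qup_Suc[OF Suc.prems t]
  proof (rule conv_min_ge_affine)
    show "ereal (\<gamma> + p \<bullet> x) \<le> Qup tr i t x" for x using Suc by simp
    show "ereal (\<gamma> + p \<bullet> x) \<le> upper_cone (Suc i) t x" for x using Suc by (intro upper_cone) simp
  qed
qed

text \<open>The affine function with slope \<open>?p\<close> and the claimed value at
  \<open>pt P t k\<close> lies below every cone. As its slope has the steepness of the cones, only
  their apexes matter: at \<open>pt P t l\<close> with \<open>l \<noteq> k\<close> it has lost more
  than \<open>\<delta>\<close> and is below \<open>val P t l\<close>, while \<open>l = k\<close>
  means that \<open>k\<close> is visited.\<close>

lemma Qup_center:
  assumes "t \<in> {1..T}" "i \<le> N" "k \<in> {1..nodes P t}"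
  shows "ereal (up_val t k + up_sum (t + 1)) \<le> Qup tr i t (center t k)"
  using assms
proof (induction "T - t" arbitrary: t i k)
  case 0
  then show ?case by (simp add: Qup_T up_val_def up_sum_def)
next
  case (Suc m)
  then have t: "t \<in> {1..<T}" by auto
  have k: "k \<in> {1..nodes P t}" by fact
  let ?w = "pt P t k"
  let ?p = "(lip P (t + 1) / R) *\<^sub>R ?w"
  let ?\<gamma> = "up_val t k + up_sum (t + 1) - ?p \<bullet> ?w"
  have upper_cone: "ereal (?\<gamma> + ?p \<bullet> x) \<le> upper_cone j t x" if j: "j \<in> {1..N}" for j x
  proof -
    obtain l where l: "l \<in> {1..nodes P t}" "l \<in> visited t" "trial tr j t = pt P t l"
      using trial_eq[OF j t(1)] .
    have "?p \<bullet> (x - pt P t l) \<le> lip P (t + 1) * norm (x - trial tr j t)"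
      using piece_lipschitz[OF t k, of "x - pt P t l"] l by simp
    moreover have "up_val t k + ?p \<bullet> (pt P t l - ?w) \<le> val P t l"
    proof (cases "l = k")
      case True
      then show ?thesis using l t by (simp add: up_val_def)
    next
      case False
      then have "?p \<bullet> (pt P t l - ?w) < - \<delta>"
        using pt_separated[OF t k l(1)] by simp
      moreover have "up_val t k \<le> 3 / 2 * \<delta>"
        using val_less[OF t k] \<delta>_pos by (simp add: up_val_def)
      ultimately show ?thesis using val_gt[OF t l(1)] by linarith
    qed
    ultimately have "?\<gamma> + ?p \<bullet> x \<le> val P t l + up_sum (t + 1) + lip P (t + 1) * norm (x - trial tr j t)"
      by (simp add: inner_diff_right)
    also have "ereal \<dots> \<le> upper_cone j t x"
    proof (rule upper_cone_ge[OF j])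
      show "t < T" using t by simp
      \<comment> \<open>The penalty outweighs any decrease of piece \<open>l\<close> away from the
        trial state.\<close>
      show "val P t l \<le> F_cost R P t z + lip P (t + 1) * norm (trial tr j t - z)" for z
        using F_cost_ge_piece[OF t l(1), of z] piece_lipschitz[OF t l(1), of "trial tr j t - z"] l
        by (simp add: piece_def inner_diff_right algebra_simps)
      show "ereal (up_val (t + 1) k' + up_sum (t + 2)) \<le> Qup tr j (t + 1) (center (t + 1) k')"
        if "k' \<in> {1..nodes P (t + 1)}" for k'
        using Suc.hyps(1)[of "t + 1" j k'] Suc.hyps(2) that j t by simp
    qed
    finally show ?thesis by simp
  qed
  have "ereal (?\<gamma> + ?p \<bullet> ?w) \<le> Qup tr i t ?w"
    using t Suc.prems upper_cone by (intro Qup_ge_affine) auto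
  then show ?case using t by (simp add: center_def)
qed

text \<open>At the root a constant minorant is enough: the slope is 0, and
  \<open>\<alpha> = 0\<close> because \<open>F_cost\<close> is nonnegative.\<close>

lemma Qup_root: "i \<le> N \<Longrightarrow> ereal (up_sum 1) \<le> Qup tr i 0 x"
proof -
  assume i: "i \<le> N"
  have "ereal (up_sum 1 + 0 \<bullet> x) \<le> upper_cone j 0 x" if j: "j \<in> {1..N}" for j x
  proof -
    have l1: "lip P 1 > 0" using lip_pos[of 1] T2 by simp
    have "ereal (0 + up_sum (0 + 1) + lip P (0 + 1) * norm (x - trial tr j 0)) \<le> upper_cone j 0 x"
      using j T2 l1 Qup_center[of 1 j] F_cost_nonneg[of 0] by (intro upper_cone_ge) (auto simp: numeral_2_eq_2)
    moreover have "ereal (up_sum 1 + 0 \<bullet> x) \<le> ereal (0 + up_sum (0 + 1) + lip P (0 + 1) * norm (x - trial tr j 0))"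
      using l1 by simp
    ultimately show ?thesis by (rule order_trans[rotated])
  qed
  then have "ereal (up_sum 1 + 0 \<bullet> x) \<le> Qup tr i 0 x"
    using T2 i by (intro Qup_ge_affine) auto
  then show ?thesis by simp
qed

section \<open>Bounds on the gap\<close>

lemma UB_ge: "i \<le> N \<Longrightarrow> ereal (up_sum 1) \<le> UB tr i"
proof (induction i)
  case 0
  then show ?case by (simp add: UB_0)
next
  case (Suc i)
  then have "root_step R tr (Suc i)" by (intro root) simp
  then show ?case using Suc Qup_root[of "Suc i"] by (simp add: root_step_def)
qed

text \<open>Visited nodes cancel, having the same upper and lower value. At least two thirds of each
  stage are unvisited, and \<open>2 / 3 * (3 / 2 * \<delta>) = \<delta>\<close>.\<close>

lemma gap_ge:
  assumes K: "\<And>t. t \<in> {1..<T} \<Longrightarrow> 3 * real N \<le> real (nodes P t)"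
  shows "ereal \<epsilon> \<le> UB tr N - ereal (LB tr N)"
proof -
  have "\<delta> \<le> (\<Sum>k = 1..nodes P t. up_val t k) / nodes P t - (\<Sum>k = 1..nodes P t. lo_val t k) / nodes P t"
    if t: "t \<in> {1..<T}" for t
  proof -
    let ?K = "nodes P t"
    have sub: "visited t \<subseteq> {1..?K}" by (auto simp: visited_def)
    have "(\<Sum>k = 1..?K. up_val t k) - (\<Sum>k = 1..?K. lo_val t k)
        = (\<Sum>k = 1..?K. if k \<in> visited t then 0 else 3 / 2 * \<delta>)"
      using t by (subst sum_subtractf[symmetric], intro sum.cong) (auto simp: up_val_def lo_val_def)
    also have "\<dots> = (\<Sum>k \<in> {1..?K} - visited t. 3 / 2 * \<delta>)"
      by (intro sum.mono_neutral_cong_right) auto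
    also have "\<dots> = (real ?K - card (visited t)) * (3 / 2 * \<delta>)"
      using sub card_mono[OF _ sub] by (simp add: card_Diff_subset finite_subset of_nat_diff)
    also have "\<dots> \<ge> (2 / 3 * real ?K) * (3 / 2 * \<delta>)"
      using card_visited[OF t] K[OF t] \<delta>_pos by (intro mult_right_mono) auto
    finally have "real ?K * \<delta> \<le> (\<Sum>k = 1..?K. up_val t k) - (\<Sum>k = 1..?K. lo_val t k)"
      by (simp add: mult.commute)
    then have "\<delta> \<le> ((\<Sum>k = 1..?K. up_val t k) - (\<Sum>k = 1..?K. lo_val t k)) / ?K"
      using nodes_pos[OF t] by (simp add: field_simps)
    then show ?thesis by (simp add: diff_divide_distrib)
  qed
  then have "(\<Sum>t = 1..<T. \<delta>) \<le> up_sum 1 - lo_sum 1"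
    unfolding up_sum_def lo_sum_def sum_subtractf[symmetric] by (intro sum_mono) auto
  moreover have "(\<Sum>t = 1..<T. \<delta>) = \<epsilon>"
    using T2 by (simp add: \<delta>_def of_nat_diff)
  ultimately have "ereal \<epsilon> \<le> ereal (up_sum 1) - ereal (LB tr N)"
    using LB_le by simp
  also have "\<dots> \<le> UB tr N - ereal (LB tr N)"
    using UB_ge[of N] by (intro ereal_minus_mono) auto
  finally show ?thesis .
qed

end

section \<open>The hard instance\<close>

text \<open>A code of unit vectors with cosine bound \<open>c = 1 - \<beta> / R\<close>, scaled by
  \<open>R\<close>: then \<open>R\<^sup>2 * (c - 1) = - \<beta> * R\<close>. A large
  \<open>\<beta>\<close> makes \<open>c\<close> negative, which is why codes for all
  \<open>c < 1\<close> are provided.\<close>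

lemma hard_stage_exists:
  fixes R \<beta> :: real
  assumes R: "R > 0" and \<beta>: "\<beta> > 0" and card: "CARD('n::finite) \<ge> 3"
  defines "d \<equiv> real CARD('n)"
  shows "\<exists>(K::nat) (w :: nat \<Rightarrow> real^'n). (\<forall>k\<in>{1..K}. norm (w k) = R) \<and>
    (\<forall>k\<in>{1..K}. \<forall>l\<in>{1..K}. l \<noteq> k \<longrightarrow> (w l - w k) \<bullet> w k < - \<beta> * R) \<and>
    real K \<ge> d * (d - 2) * sqrt pi / (d - 1) * (Gamma (d / 2 + 1 / 2) / Gamma (d / 2 + 1))
      * (R / (2 * \<beta>)) powr ((d - 2) / 2)"
proof -
  define c where "c = 1 - \<beta> / R"
  have c: "c < 1" using R \<beta> by (simp add: c_def)
  have d: "d \<ge> 3" using card by (simp add: d_def)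
  obtain S :: "(real^'n) set" where S: "finite S" "\<And>w. w \<in> S \<Longrightarrow> norm w = 1"
    "\<And>v w. v \<in> S \<Longrightarrow> w \<in> S \<Longrightarrow> v \<noteq> w \<Longrightarrow> v \<bullet> w < c"
    and cardS: "d * (d - 2) / (d - 1) * (unit_ball_vol d / unit_ball_vol (d - 1))
      \<le> real (card S) * sqrt (2 * (1 - c)) ^ (CARD('n) - 2)"
    using spherical_code_exists[OF c card, folded d_def] by blast
  obtain h where h: "bij_betw h {1..card S} S"
    using ex_bij_betw_nat_finite_1[OF S(1)] by blast
  define w where "w k = R *\<^sub>R h k" for k
  have hS: "h k \<in> S" if "k \<in> {1..card S}" for k
    by (rule bij_betw_apply[OF h that])
  have sep: "(w l - w k) \<bullet> w k < - \<beta> * R"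
    if "k \<in> {1..card S}" "l \<in> {1..card S}" "l \<noteq> k" for k l
  proof -
    have "h l \<noteq> h k"
      using inj_onD[OF bij_betw_imp_inj_on[OF h]] that by blast
    then have "h l \<bullet> h k < c" using S(3) hS that by blast
    then have "R\<^sup>2 * (h l \<bullet> h k - 1) < R\<^sup>2 * (c - 1)"
      using R by (intro mult_strict_left_mono) auto
    also have "\<dots> = - \<beta> * R" using R by (simp add: c_def power2_eq_square)
    also have "R\<^sup>2 * (h l \<bullet> h k - 1) = (w l - w k) \<bullet> w k"
      using S(2)[OF hS[OF that(1)]]
      by (simp add: w_def inner_diff_left dot_square_norm power2_eq_square algebra_simps)
    finally show ?thesis .
  qed
  define q where "q = 2 * (1 - c)"
  have q: "q > 0" "R / (2 * \<beta>) = 1 / q"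
    using R \<beta> by (simp_all add: q_def c_def)
  \<comment> \<open>The Gamma quotient, up to the factor \<open>sqrt pi\<close>, is a ratio of
    volumes of unit balls in consecutive dimensions.\<close>
  have "unit_ball_vol d / unit_ball_vol (d - 1)
      = pi powr (d / 2 - (d - 1) / 2) * Gamma ((d - 1) / 2 + 1) / Gamma (d / 2 + 1)"
    by (simp add: unit_ball_vol_def powr_diff)
  also have "\<dots> = sqrt pi * (Gamma (d / 2 + 1 / 2) / Gamma (d / 2 + 1))"
    by (simp add: powr_half_sqrt diff_divide_distrib add.commute)
  finally have "d * (d - 2) * sqrt pi / (d - 1) * (Gamma (d / 2 + 1 / 2) / Gamma (d / 2 + 1))
      = d * (d - 2) / (d - 1) * (unit_ball_vol d / unit_ball_vol (d - 1))"
    by simp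
  also have "\<dots> \<le> real (card S) * q powr ((d - 2) / 2)"
  proof -
    have "sqrt q ^ (CARD('n) - 2) = (q powr (1 / 2)) powr real (CARD('n) - 2)"
      using q by (simp add: powr_half_sqrt powr_realpow)
    also have "\<dots> = q powr ((d - 2) / 2)"
      using card by (simp add: powr_powr d_def of_nat_diff)
    finally show ?thesis using cardS by (simp add: q_def)
  qed
  finally have "d * (d - 2) * sqrt pi / (d - 1) * (Gamma (d / 2 + 1 / 2) / Gamma (d / 2 + 1))
      * (R / (2 * \<beta>)) powr ((d - 2) / 2)
      \<le> (real (card S) * q powr ((d - 2) / 2)) * (R / (2 * \<beta>)) powr ((d - 2) / 2)"
    by (intro mult_right_mono) auto
  also have "\<dots> = real (card S)"
    using q by (simp add: powr_divide)
  finally show ?thesis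
    using sep S(2)[OF hS] R by (intro exI[of _ "card S"] exI[of _ w]) (auto simp: w_def)
qed

theorem theorem5:
  fixes T :: nat and L D R \<epsilon> d :: real
  assumes "T \<ge> 2" and "CARD('n::finite) \<ge> 3" and "d = real CARD('n)"
    and "L > 0" and "D = 2 * R" and "D > 0" and "\<epsilon> > 0"
  shows "\<exists>P :: 'n msp. hard_form T R L \<epsilon> P \<and>
    (\<forall>tr i. algorithm_run T R \<epsilon> P tr i \<and> UB tr i - ereal (LB tr i) < ereal \<epsilon> \<longrightarrow>
      real i > 1 / 3 * (d * (d - 2) * sqrt pi / (d - 1))
                 * (Gamma (d / 2 + 1 / 2) / Gamma (d / 2 + 1))
                 * (D * L * (real T - 1) / (8 * \<epsilon>)) powr ((d - 2) / 2))"
proof -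
  have R: "R > 0" using assms by simp
  have T: "real T - 1 > 0" using assms by simp
  have d: "d \<ge> 3" using assms by simp
  \<comment> \<open>Linear interpolation from \<open>L\<close> at 0 to \<open>L / 2\<close> at
    \<open>T\<close>, hence strictly decreasing.\<close>
  define lp where "lp t = L * (1 - real t / (2 * real T))" for t
  have lp_T: "lp T = L / 2" using assms by (simp add: lp_def)
  have lp_1: "lp 1 \<le> L" using assms by (simp add: lp_def)
  have lp_less: "lp (t + 1) < lp t" for t
    using assms by (simp add: lp_def divide_strict_right_mono)
  have lp_ge: "L / 2 \<le> lp (t + 1)" if "t \<in> {1..<T}" for t
  proof -
    have "L * (1 / 2) \<le> L * (1 - real (t + 1) / (2 * real T))"
      using assms that by (intro mult_left_mono) (auto simp: field_simps)
    then show ?thesis by (simp add: lp_def)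
  qed
  define \<beta> where "\<beta> t = \<epsilon> / ((real T - 1) * lp (t + 1))" for t
  define C where "C = d * (d - 2) * sqrt pi / (d - 1) * (Gamma (d / 2 + 1 / 2) / Gamma (d / 2 + 1))"
  have C: "C > 0"
    unfolding C_def using d by (intro mult_pos_pos divide_pos_pos Gamma_real_pos) auto
  define pack where "pack t K w \<longleftrightarrow> (\<forall>k\<in>{1..K}. norm (w k) = R) \<and>
    (\<forall>k\<in>{1..K}. \<forall>l\<in>{1..K}. l \<noteq> k \<longrightarrow> (w l - w k) \<bullet> w k < - \<beta> t * R) \<and>
    real K \<ge> C * (R / (2 * \<beta> t)) powr ((d - 2) / 2)" for t and K :: nat and w :: "nat \<Rightarrow> real^'n"
  have "\<exists>K w. pack t K w" if "t \<in> {1..<T}" for t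
  proof -
    have "\<beta> t > 0"
      using lp_ge[OF that] assms T by (simp add: \<beta>_def)
    from hard_stage_exists[OF R this assms(2)] show ?thesis
      by (simp add: pack_def C_def assms(3))
  qed
  then obtain K w where pack: "\<And>t. t \<in> {1..<T} \<Longrightarrow> pack t (K t) (w t)"
    by metis
  \<comment> \<open>The factor \<open>3 / 4\<close> is the middle of the prescribed range of
    \<open>val\<close>.\<close>
  define P :: "'n msp" where "P = \<lparr>lip = lp, nodes = (\<lambda>t. if t = T then 1 else K t), pt = w,
    val = (\<lambda>t k. 3 / 4 * (\<epsilon> / (real T - 1)))\<rparr>"
  have P [simp]: "lip P = lp" "nodes P t = (if t = T then 1 else K t)" "pt P = w"
    "val P t k = 3 / 4 * (\<epsilon> / (real T - 1))" for t k
    by (simp_all add: P_def)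
  have hard: "hard_form T R L \<epsilon> P"
    unfolding hard_form_def Let_def
  proof (intro conjI ballI)
    fix t assume "t \<in> {1..T - 1}"
    then have t: "t \<in> {1..<T}" "t \<noteq> T" using assms(1) by auto
    note p = pack[OF t(1), unfolded pack_def C_def \<beta>_def assms(3)]
    show "norm (pt P t k) = R" if "k \<in> {1..nodes P t}" for k
      using p t that by simp
    show "l \<noteq> k \<longrightarrow> (pt P t l - pt P t k) \<bullet> pt P t k < - (\<epsilon> / ((real T - 1) * lip P (t + 1))) * R"
      if "k \<in> {1..nodes P t}" "l \<in> {1..nodes P t}" for k l
      using p t that unfolding P by (simp only: if_False) blast
    show "real CARD('n) * (real CARD('n) - 2) * sqrt pi / (real CARD('n) - 1) *
        (Gamma (real CARD('n) / 2 + 1 / 2) / Gamma (real CARD('n) / 2 + 1)) *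
        (R / (2 * (\<epsilon> / ((real T - 1) * lip P (t + 1))))) powr ((real CARD('n) - 2) / 2)
        \<le> real (nodes P t)"
      using p t unfolding P by (simp only: if_False)
    show "\<epsilon> / (2 * (real T - 1)) < val P t k" "val P t k < \<epsilon> / (real T - 1)" for k
      using assms T by (simp_all add: field_simps)
  qed (use lp_T lp_1 lp_less in auto)
  \<comment> \<open>The base \<open>R / (2 * \<beta> t)\<close> is proportional to
    \<open>lp (t + 1)\<close>; the bound \<open>lp (t + 1) \<ge> L / 2\<close> and
    \<open>D = 2 * R\<close> produce the 8.\<close>
  have K_ge: "C * (D * L * (real T - 1) / (8 * \<epsilon>)) powr ((d - 2) / 2) \<le> real (nodes P t)"
    if t: "t \<in> {1..<T}" for t
  proof -
    have "D * L * (real T - 1) / (8 * \<epsilon>) = R * (real T - 1) / (2 * \<epsilon>) * (L / 2)"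
      using assms by simp
    also have "\<dots> \<le> R * (real T - 1) / (2 * \<epsilon>) * lp (t + 1)"
      using lp_ge[OF t] R T assms by (intro mult_left_mono) auto
    also have "\<dots> = R / (2 * \<beta> t)"
      by (simp add: \<beta>_def)
    finally have "(D * L * (real T - 1) / (8 * \<epsilon>)) powr ((d - 2) / 2) \<le> (R / (2 * \<beta> t)) powr ((d - 2) / 2)"
      using assms T d by (intro powr_mono2) auto
    then have "C * (D * L * (real T - 1) / (8 * \<epsilon>)) powr ((d - 2) / 2)
        \<le> C * (R / (2 * \<beta> t)) powr ((d - 2) / 2)"
      using C by (intro mult_left_mono) auto
    also have "\<dots> \<le> real (nodes P t)"
      using pack[OF t] t by (simp add: pack_def)
    finally show ?thesis .
  qed
  have nodes_pos: "nodes P t > 0" if "t \<in> {1..<T}" for t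
  proof -
    have "0 < C * (D * L * (real T - 1) / (8 * \<epsilon>)) powr ((d - 2) / 2)"
      using C assms T by simp
    then have "0 < real (nodes P t)"
      using K_ge[OF that] by linarith
    then show ?thesis by (simp only: of_nat_0_less_iff)
  qed
  have lower: "real i > 1 / 3 * (C * (D * L * (real T - 1) / (8 * \<epsilon>)) powr ((d - 2) / 2))"
    if run: "algorithm_run T R \<epsilon> P tr i" and gap: "UB tr i - ereal (LB tr i) < ereal \<epsilon>" for tr i
  proof (rule ccontr)
    interpret dual_dp_run T i R L \<epsilon> P tr
      using assms R nodes_pos hard run by unfold_locales
    assume "\<not> ?thesis"
    \<comment> \<open>If the bound fails, a third of the nodes of every stage below \<open>T\<close>
      is at least \<open>i\<close>, so the gap cannot have closed.\<close>
    then have "3 * real i \<le> real (nodes P t)" if "t \<in> {1..<T}" for t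
      using K_ge[OF that] by linarith
    then have "ereal \<epsilon> \<le> UB tr i - ereal (LB tr i)" by (rule gap_ge)
    with gap show False by simp
  qed
  have C_eq: "1 / 3 * (d * (d - 2) * sqrt pi / (d - 1)) * (Gamma (d / 2 + 1 / 2) / Gamma (d / 2 + 1)) * x
      = 1 / 3 * (C * x)" for x
    unfolding C_def by (simp only: mult.assoc)
  show ?thesis
    unfolding C_eq using hard lower by blast
qed

end
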